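(* Let $(M,F)$ be a Finsler space and let $h$ be its isotropic average metric. If $(M,F)$ is a Finsler symmetric space, then $(M,h)$ is a Riemannian symmetric space.
   Context: The summation convention is used. $M$ is an $n$-dimensional smooth manifold, $N=TM\setminus\{0\}$ is the slit tangent bundle, and local coordinates $(x^i)$ on $M$ induce natural coordinates $(x^i,y^i)$ on $TM$. A Finsler space $(M,F)$ is a manifold $M$ with a function $F:TM\to[0,\infty)$ that is smooth on $N$, satisfies $F(x,\lambda y)=\lambda F(x,y)$ for $\lambda\ge 0$ (reversibility $F(x,-y)=F(x,y)$ is not assumed), and for which $g_{ij}(x,y):=\frac12\frac{\partial^2F^2}{\partial y^i\partial y^j}$ is positive definite on $N$. The indicatrix is $I_x=\{y\in T_xM:F(x,y)=1\}$. Its volume form $dvol_x$ is the pull-back to $I_x$ of the contraction of $\sqrt{\det g}\,\frac{\delta y^1}{F}\wedge\cdots\wedge\frac{\delta y^n}{F}$ with $l=\frac{y^i}{F}\frac{\partial}{\partial y^i}$ ($\delta y^i$ restricts to $dy^i$ on the fibers; $I_x$ is oriented so that $dvol_x$ is positive). Put $vol(I_x)=\int_{I_x}dvol_x$ and $\langle f\rangle(x)=\frac1{vol(I_x)}\int_{I_x}f(x,y)\,dvol_x$. The isotropic average metric is the Riemannian metric $h=\langle g_{ij}\rangle\,dx^i\otimes dx^j$ on $M$. A Finsler isometry of $(M,F)$ is a diffeomorphism $\Phi:M\to M$ with $F(\Phi(x),d\Phi(y))=F(x,y)$ for all $x\in M$, $y\in T_xM$. $(M,F)$ is (Finsler) symmetric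 if for each $x\in M$ there is a Finsler isometry $\varphi_x:M\to M$ with $\varphi_x(x)=x$ and $(d\varphi_x)|_x=-Id|_{T_xM}$. $(M,h)$ is a Riemannian symmetric space if for each $x\in M$ there is an isometry $\varphi_x$ of $h$ with the same two properties. *)

theory Defs
  imports "HOL-Analysis.Analysis"
begin

section \<open>Smooth maps between open subsets of Euclidean spaces\<close>

primrec Ck_on :: "nat \<Rightarrow> ('a::real_normed_vector) set \<Rightarrow> ('a \<Rightarrow> 'b::real_normed_vector) \<Rightarrow> bool" where
  "Ck_on 0 S f \<longleftrightarrow> continuous_on S f"
| "Ck_on (Suc k) S f \<longleftrightarrow>
     (\<forall>x\<in>S. f differentiable (at x)) \<and> (\<forall>v. Ck_on k S (\<lambda>x. frechet_derivative f (at x) v))"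

definition smooth_on :: "('a::real_normed_vector) set \<Rightarrow> ('a \<Rightarrow> 'b::real_normed_vector) \<Rightarrow> bool" where
  "smooth_on S f \<longleftrightarrow> (\<forall>k. Ck_on k S f)"

definition partial_deriv :: "'n \<Rightarrow> (real^'n::finite \<Rightarrow> 'b::real_normed_vector) \<Rightarrow> real^'n \<Rightarrow> 'b" where
  "partial_deriv j f y = frechet_derivative f (at y) (axis j 1)"


section \<open>Smooth manifolds\<close>

text \<open>A chart is a pair of its domain and its coordinate map; the values of the coordinate map
  outside the domain are irrelevant.\<close>

type_synonym ('a, 'n) chart = "'a set \<times> ('a \<Rightarrow> real^'n)"

definition chart_inv :: "('a, 'n) chart \<Rightarrow> real^'n \<Rightarrow> 'a" where
  "chart_inv c = inv_into (fst c) (snd c)"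

definition transition :: "('a, 'n) chart \<Rightarrow> ('a, 'n) chart \<Rightarrow> real^'n \<Rightarrow> real^'n" where
  "transition c d = snd d \<circ> chart_inv c"

text \<open>The smooth structure is given by a smooth atlas, which need not be maximal. The dimension is
  \<open>CARD('n)\<close>.\<close>

definition smooth_manifold :: "'a topology \<Rightarrow> ('a, 'n::finite) chart set \<Rightarrow> bool" where
  "smooth_manifold X A \<longleftrightarrow>
     Hausdorff_space X \<and> second_countable X \<and>
     (\<Union>c\<in>A. fst c) = topspace X \<and>
     (\<forall>c\<in>A. openin X (fst c) \<and> open (snd c ` fst c) \<and>
        homeomorphic_map (subtopology X (fst c)) (top_of_set (snd c ` fst c)) (snd c)) \<and>
     (\<forall>c\<in>A. \<forall>d\<in>A. smooth_on (snd c ` (fst c \<inter> fst d)) (transition c d))"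

definition chart_at :: "('a, 'n) chart set \<Rightarrow> 'a \<Rightarrow> ('a, 'n) chart" where
  "chart_at A p = (SOME c. c \<in> A \<and> p \<in> fst c)"

text \<open>A tangent vector at \<open>p\<close> is the family of its coordinate vectors in all charts around \<open>p\<close>,
  related by the Jacobians of the transition maps. The value \<open>0\<close> at the other charts makes the
  representation unique, so that the vector space operations are the pointwise ones.\<close>

type_synonym ('a, 'n) tangent = "('a, 'n) chart \<Rightarrow> real^'n"

definition tangent_space :: "('a, 'n::finite) chart set \<Rightarrow> 'a \<Rightarrow> ('a, 'n) tangent set" where
  "tangent_space A p =
     {v. (\<forall>c\<in>A. \<forall>d\<in>A. p \<in> fst c \<and> p \<in> fst d \<longrightarrow>
            v d = frechet_derivative (transition c d) (at (snd c p)) (v c)) \<and>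
         (\<forall>c. \<not> (c \<in> A \<and> p \<in> fst c) \<longrightarrow> v c = 0)}"

text \<open>The tangent vector \<open>y\<^sup>i \<partial>/\<partial>x\<^sup>i\<close> at \<open>p\<close>, where \<open>x\<close> are the coordinates of the chart \<open>c\<close>.\<close>

definition coord_vector :: "('a, 'n::finite) chart set \<Rightarrow> ('a, 'n) chart \<Rightarrow> 'a \<Rightarrow> real^'n \<Rightarrow> ('a, 'n) tangent" where
  "coord_vector A c p y =
     (\<lambda>d. if d \<in> A \<and> p \<in> fst d then frechet_derivative (transition c d) (at (snd c p)) y else 0)"

definition smooth_map :: "'a topology \<Rightarrow> ('a, 'n::finite) chart set \<Rightarrow> ('a \<Rightarrow> 'a) \<Rightarrow> bool" where
  "smooth_map X A \<Phi> \<longleftrightarrow>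
     continuous_map X X \<Phi> \<and>
     (\<forall>c\<in>A. \<forall>d\<in>A. smooth_on (snd c ` {p \<in> fst c. \<Phi> p \<in> fst d}) (snd d \<circ> \<Phi> \<circ> chart_inv c))"

definition diffeomorphism :: "'a topology \<Rightarrow> ('a, 'n::finite) chart set \<Rightarrow> ('a \<Rightarrow> 'a) \<Rightarrow> bool" where
  "diffeomorphism X A \<Phi> \<longleftrightarrow>
     bij_betw \<Phi> (topspace X) (topspace X) \<and>
     smooth_map X A \<Phi> \<and> smooth_map X A (inv_into (topspace X) \<Phi>)"

text \<open>The differential \<open>T\<^sub>pM \<rightarrow> T\<^bsub>\<Phi> p\<^esub>M\<close>; it does not depend on the chart chosen around \<open>p\<close>.\<close>

definition differential ::
  "('a, 'n::finite) chart set \<Rightarrow> ('a \<Rightarrow> 'a) \<Rightarrow> 'a \<Rightarrow> ('a, 'n) tangent \<Rightarrow> ('a, 'n) tangent" where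
  "differential A \<Phi> p v =
     (\<lambda>d. if d \<in> A \<and> \<Phi> p \<in> fst d
          then let c = chart_at A p
               in frechet_derivative (snd d \<circ> \<Phi> \<circ> chart_inv c) (at (snd c p)) (v c)
          else 0)"


section \<open>Finsler spaces\<close>

text \<open>\<open>F p v\<close> is only relevant for \<open>p\<close> in the manifold and \<open>v\<close> in the tangent space at \<open>p\<close>.
  \<open>finsler_coord A F c x y\<close> is \<open>F\<close> in the natural coordinates \<open>(x, y)\<close> induced by the chart \<open>c\<close>.\<close>

definition finsler_coord ::
  "('a, 'n::finite) chart set \<Rightarrow> ('a \<Rightarrow> ('a, 'n) tangent \<Rightarrow> real) \<Rightarrow> ('a, 'n) chart \<Rightarrow> real^'n \<Rightarrow> real^'n \<Rightarrow> real" where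
  "finsler_coord A F c x y = F (chart_inv c x) (coord_vector A c (chart_inv c x) y)"

text \<open>The matrix \<open>g\<^sub>i\<^sub>j = 1/2 \<partial>\<^sup>2f\<^sup>2/\<partial>y\<^sup>i\<partial>y\<^sup>j\<close> for a function \<open>f\<close> on one fibre.\<close>

definition fundamental_tensor :: "(real^'n::finite \<Rightarrow> real) \<Rightarrow> real^'n \<Rightarrow> real^'n^'n" where
  "fundamental_tensor f y = (\<chi> i j. (1/2) * partial_deriv i (partial_deriv j (\<lambda>z. (f z)\<^sup>2)) y)"

definition finsler_space ::
  "'a topology \<Rightarrow> ('a, 'n::finite) chart set \<Rightarrow> ('a \<Rightarrow> ('a, 'n) tangent \<Rightarrow> real) \<Rightarrow> bool" where
  "finsler_space X A F \<longleftrightarrow>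
     smooth_manifold X A \<and>
     (\<forall>p\<in>topspace X. \<forall>v\<in>tangent_space A p. 0 \<le> F p v) \<and>
     (\<forall>p\<in>topspace X. \<forall>v\<in>tangent_space A p. \<forall>t\<ge>0. F p (\<lambda>c. t *\<^sub>R v c) = t * F p v) \<and>
     (\<forall>c\<in>A. smooth_on ((snd c ` fst c) \<times> (- {0})) (\<lambda>(x, y). finsler_coord A F c x y)) \<and>
     (\<forall>c\<in>A. \<forall>x\<in>snd c ` fst c. \<forall>y. y \<noteq> 0 \<longrightarrow>
        (\<forall>w. w \<noteq> 0 \<longrightarrow> 0 < w \<bullet> (fundamental_tensor (finsler_coord A F c x) y *v w)))"

definition finsler_isometry ::
  "'a topology \<Rightarrow> ('a, 'n::finite) chart set \<Rightarrow> ('a \<Rightarrow> ('a, 'n) tangent \<Rightarrow> real) \<Rightarrow> ('a \<Rightarrow> 'a) \<Rightarrow> bool" where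
  "finsler_isometry X A F \<Phi> \<longleftrightarrow>
     diffeomorphism X A \<Phi> \<and>
     (\<forall>p\<in>topspace X. \<forall>v\<in>tangent_space A p. F (\<Phi> p) (differential A \<Phi> p v) = F p v)"

definition finsler_symmetric ::
  "'a topology \<Rightarrow> ('a, 'n::finite) chart set \<Rightarrow> ('a \<Rightarrow> ('a, 'n) tangent \<Rightarrow> real) \<Rightarrow> bool" where
  "finsler_symmetric X A F \<longleftrightarrow>
     (\<forall>p\<in>topspace X. \<exists>\<phi>. finsler_isometry X A F \<phi> \<and> \<phi> p = p \<and>
        (\<forall>v\<in>tangent_space A p. differential A \<phi> p v = (\<lambda>c. - v c)))"


section \<open>Integration over the indicatrix\<close>

text \<open>In this section \<open>f\<close> is the Finsler function on one tangent space, in the natural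
  coordinates \<open>y\<close> of some chart.\<close>

definition indicatrix :: "(real^'n::finite \<Rightarrow> real) \<Rightarrow> (real^'n) set" where
  "indicatrix f = {y. f y = 1}"

text \<open>The value on vectors \<open>w\<^sub>j\<close> \<open>(j \<noteq> k)\<close> of the contraction of
  \<open>sqrt (det g) dy\<^sup>1/F \<and> \<dots> \<and> dy\<^sup>n/F\<close> with \<open>l = y/F\<close>: the vector \<open>l\<close> is put in the slot \<open>k\<close>. As the
  index type is not ordered, this value is only defined up to a sign, which is immaterial below,
  where the indicatrix is oriented by the form itself.\<close>

definition indicatrix_form ::
  "(real^'n::finite \<Rightarrow> real) \<Rightarrow> real^'n \<Rightarrow> 'n \<Rightarrow> ('n \<Rightarrow> real^'n) \<Rightarrow> real" where
  "indicatrix_form f y k w =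
     sqrt (det (fundamental_tensor f y)) *
     det (\<chi> i. (1 / f y) *\<^sub>R (if i = k then (1 / f y) *\<^sub>R y else w i))"

text \<open>The coordinate hyperplane \<open>{u. u $ k = 0}\<close> with its Lebesgue measure plays the role of
  \<open>\<real>\<^bsup>n-1\<^esup>\<close> (a point of mass 1 if \<open>n = 1\<close>).\<close>

definition hyperplane :: "'n \<Rightarrow> (real^'n::finite) set" where
  "hyperplane k = {u. u $ k = 0}"

definition hyperplane_lborel :: "'n \<Rightarrow> (real^'n::finite) measure" where
  "hyperplane_lborel k =
     distr (Pi\<^sub>M (UNIV - {k}) (\<lambda>_. lborel)) borel (\<lambda>u. \<chi> j. if j = k then 0 else u j)"

text \<open>Smooth injective immersions into \<open>S\<close> of the open subset \<open>W \<inter> hyperplane k\<close> of the hyperplane.\<close>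

definition local_parametrization ::
  "(real^'n::finite) set \<Rightarrow> 'n \<Rightarrow> (real^'n) set \<Rightarrow> (real^'n \<Rightarrow> real^'n) \<Rightarrow> bool" where
  "local_parametrization S k W \<psi> \<longleftrightarrow>
     open W \<and> smooth_on W \<psi> \<and> inj_on \<psi> (W \<inter> hyperplane k) \<and> \<psi> ` (W \<inter> hyperplane k) \<subseteq> S \<and>
     (\<forall>u\<in>W \<inter> hyperplane k. inj_on (frechet_derivative \<psi> (at u)) (hyperplane k))"

text \<open>The Borel measure of the volume form on the positively oriented indicatrix: in every local
  parametrization it is given by the pull-back of the form.\<close>

definition indicatrix_measure :: "(real^'n::finite \<Rightarrow> real) \<Rightarrow> (real^'n) measure" where
  "indicatrix_measure f =
     (THE \<mu>. sets \<mu> = sets (restrict_space borel (indicatrix f)) \<and>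
        (\<forall>k W \<psi> B. local_parametrization (indicatrix f) k W \<psi> \<and> B \<in> sets borel \<and>
            B \<subseteq> \<psi> ` (W \<inter> hyperplane k) \<longrightarrow>
          emeasure \<mu> B =
            (\<integral>\<^sup>+u\<in>{u \<in> W \<inter> hyperplane k. \<psi> u \<in> B}.
               ennreal \<bar>indicatrix_form f (\<psi> u) k (\<lambda>j. partial_deriv j \<psi> u)\<bar> \<partial>hyperplane_lborel k)))"

definition indicatrix_average :: "(real^'n::finite \<Rightarrow> real) \<Rightarrow> (real^'n \<Rightarrow> real) \<Rightarrow> real" where
  "indicatrix_average f \<phi> =
     (\<integral>y. \<phi> y \<partial>indicatrix_measure f) / measure (indicatrix_measure f) (indicatrix f)"


section \<open>The isotropic average metric\<close>

text \<open>\<open>h = \<langle>g\<^sub>i\<^sub>j\<rangle> dx\<^sup>i \<otimes> dx\<^sup>j\<close>, evaluated in a chart around \<open>p\<close>; the result does not depend on the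
  chart.\<close>

definition isotropic_average_metric ::
  "('a, 'n::finite) chart set \<Rightarrow> ('a \<Rightarrow> ('a, 'n) tangent \<Rightarrow> real) \<Rightarrow>
   'a \<Rightarrow> ('a, 'n) tangent \<Rightarrow> ('a, 'n) tangent \<Rightarrow> real" where
  "isotropic_average_metric A F p u v =
     (let c = chart_at A p; f = finsler_coord A F c (snd c p)
      in \<Sum>i\<in>UNIV. \<Sum>j\<in>UNIV.
           indicatrix_average f (\<lambda>y. fundamental_tensor f y $ i $ j) * u c $ i * v c $ j)"


section \<open>Riemannian symmetric spaces\<close>

definition riemannian_metric ::
  "'a topology \<Rightarrow> ('a, 'n::finite) chart set \<Rightarrow>
   ('a \<Rightarrow> ('a, 'n) tangent \<Rightarrow> ('a, 'n) tangent \<Rightarrow> real) \<Rightarrow> bool" where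
  "riemannian_metric X A h \<longleftrightarrow>
     (\<forall>p\<in>topspace X.
        (\<forall>u\<in>tangent_space A p. \<forall>v\<in>tangent_space A p. h p u v = h p v u) \<and>
        (\<forall>u\<in>tangent_space A p. \<forall>v\<in>tangent_space A p. \<forall>w\<in>tangent_space A p. \<forall>a b.
           h p (\<lambda>c. a *\<^sub>R u c + b *\<^sub>R v c) w = a * h p u w + b * h p v w) \<and>
        (\<forall>u\<in>tangent_space A p. u \<noteq> (\<lambda>_. 0) \<longrightarrow> 0 < h p u u)) \<and>
     (\<forall>c\<in>A. \<forall>i j. smooth_on (snd c ` fst c)
        (\<lambda>x. let p = chart_inv c x
             in h p (coord_vector A c p (axis i 1)) (coord_vector A c p (axis j 1))))"

definition riemannian_isometry ::
  "'a topology \<Rightarrow> ('a, 'n::finite) chart set \<Rightarrow>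
   ('a \<Rightarrow> ('a, 'n) tangent \<Rightarrow> ('a, 'n) tangent \<Rightarrow> real) \<Rightarrow> ('a \<Rightarrow> 'a) \<Rightarrow> bool" where
  "riemannian_isometry X A h \<Phi> \<longleftrightarrow>
     diffeomorphism X A \<Phi> \<and>
     (\<forall>p\<in>topspace X. \<forall>u\<in>tangent_space A p. \<forall>v\<in>tangent_space A p.
        h (\<Phi> p) (differential A \<Phi> p u) (differential A \<Phi> p v) = h p u v)"

definition riemannian_symmetric_space ::
  "'a topology \<Rightarrow> ('a, 'n::finite) chart set \<Rightarrow>
   ('a \<Rightarrow> ('a, 'n) tangent \<Rightarrow> ('a, 'n) tangent \<Rightarrow> real) \<Rightarrow> bool" where
  "riemannian_symmetric_space X A h \<longleftrightarrow>
     smooth_manifold X A \<and> riemannian_metric X A h \<and>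
     (\<forall>p\<in>topspace X. \<exists>\<phi>. riemannian_isometry X A h \<phi> \<and> \<phi> p = p \<and>
        (\<forall>v\<in>tangent_space A p. differential A \<phi> p v = (\<lambda>c. - v c)))"

end

theory Submission
  imports Defs
begin

text \<open>The idea is that everything in the definition of the isotropic average metric \<open>h\<close> at a point \<open>p\<close> is
built from one object, the Minkowski norm \<open>F p\<close> on the tangent space. A Finsler isometry \<open>\<Phi>\<close> has a linear
differential that carries \<open>F p\<close> to \<open>F (\<Phi> p)\<close>, so it carries \<open>h p\<close> to \<open>h (\<Phi> p)\<close> as soon as averaging over
the indicatrix commutes with linear isomorphisms (\<open>average_form_linear\<close>). Hence the symmetries of
\<open>(M, F)\<close> are symmetries of \<open>(M, h)\<close>. The same statement, applied to the Jacobian of a transition map, shows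
that \<open>h\<close> does not depend on the chart.

What remains is that \<open>h\<close> is a Riemannian metric at all. The measure on the indicatrix is only
characterized by its values in local parametrizations, so existence and uniqueness have to be proved
before anything can be said about averages, and then smoothness in \<open>p\<close> has to be shown although the
indicatrix moves with \<open>p\<close>. Both come from one formula: if \<open>f\<close> is a Minkowski norm on \<open>\<real>\<^sup>n\<close> with
fundamental tensor \<open>g\<close>, and \<open>\<phi>\<close> is homogeneous of degree 0, then

\<open>\<integral> \<phi> dvol = 1 / ln 2 * \<integral>\<^bsub>1 \<le> q y \<le> 2\<^esub> \<phi> y * sqrt (det (g y)) / f y ^ n dy\<close>

for \<^emph>\<open>every\<close> continuous, positive, 1-homogeneous function \<open>q\<close>. The integrand besides \<open>\<phi>\<close> is homogeneous of
degree \<open>-n\<close>, so in coordinates \<open>y = exp r *\<^sub>R \<psi> u\<close> along a parametrization \<open>\<psi>\<close> of the indicatrix it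
does not depend on \<open>r\<close>, and each ray meets the shell \<open>1 \<le> q \<le> 2\<close> in an \<open>r\<close>-interval of length \<open>ln 2\<close>
(\<open>cone_measure_local_parametrization\<close>). Uniqueness holds because the indicatrix is covered by \<open>2n\<close> radial
charts (\<open>radial_chart\<close>).

The freedom in \<open>q\<close> does the rest. With \<open>q = norm\<close> the domain is a fixed compact set that avoids the
origin, so \<open>h\<close> is smooth by differentiation under the integral sign (\<open>smooth_on_average_form\<close>). With
\<open>q y = norm (L y)\<close> for a linear isomorphism \<open>L\<close> the shell is mapped by \<open>L\<close> to the standard one, and the
linear change of variables gives the invariance (\<open>average_form_linear\<close>).\<close>


section \<open>The calculus of smooth maps\<close>

lemma Ck_on_cong:
  assumes "open S" "\<And>x. x \<in> S \<Longrightarrow> f x = g x" "Ck_on k S f"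
  shows "Ck_on k S g"
  using assms(2,3)
proof (induction k arbitrary: f g)
  case 0
  then show ?case by (simp cong: continuous_on_cong)
next
  case (Suc k)
  have d: "g differentiable (at x)" if "x \<in> S" for x
    using Suc.prems that assms(1) unfolding differentiable_def Ck_on.simps
    by (metis has_derivative_transform_within_open)
  have e: "frechet_derivative f (at x) = frechet_derivative g (at x)" if "x \<in> S" for x
    using Suc.prems that assms(1) by (intro frechet_derivative_transform_within_open[where X=S]) auto
  show ?case
    using d e Suc.IH[of "\<lambda>x. frechet_derivative f (at x) v" "\<lambda>x. frechet_derivative g (at x) v" for v] Suc.prems(2)
    by auto
qed

lemma Ck_on_SucD: "Ck_on (Suc k) S f \<Longrightarrow> Ck_on k S f"
proof (induction k arbitrary: f)
  case 0
  then show ?case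
    unfolding Ck_on.simps
    by (meson continuous_at_imp_continuous_on differentiable_imp_continuous_within)
next
  case (Suc k)
  then have "\<forall>x\<in>S. f differentiable at x" and
    "Ck_on (Suc k) S (\<lambda>x. frechet_derivative f (at x) v)" for v
    by (metis Ck_on.simps(2))+
  then show ?case using Suc.IH by (subst Ck_on.simps) blast
qed

text \<open>Together with the closure of \<open>Ck_on k\<close> under the operations in the derivative, this turns each rule of
differentiation into the induction step of a closure property of \<open>Ck_on\<close>.\<close>

lemma Ck_on_Suc_derivI:
  assumes "open S" "\<And>x. x \<in> S \<Longrightarrow> (f has_derivative f' x) (at x)" "\<And>v. Ck_on k S (\<lambda>x. f' x v)"
  shows "Ck_on (Suc k) S f"
proof -
  have "frechet_derivative f (at x) = f' x" if "x \<in> S" for x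
    using assms(2)[OF that] frechet_derivative_at by metis
  then have "Ck_on k S (\<lambda>x. frechet_derivative f (at x) v)" for v
    using Ck_on_cong[OF assms(1), of "\<lambda>x. f' x v"] assms(3) by simp
  then show ?thesis using assms(2) by (auto simp: differentiable_def)
qed

lemma Ck_on_has_derivative:
  "Ck_on (Suc k) S f \<Longrightarrow> x \<in> S \<Longrightarrow> (f has_derivative frechet_derivative f (at x)) (at x)"
  by (auto simp: frechet_derivative_works)

lemma Ck_on_const: "Ck_on k S (\<lambda>x. c)"
  by (induction k arbitrary: c) (simp_all add: frechet_derivative_const)

lemma Ck_on_affine:
  assumes "bounded_linear l" "open S"
  shows "Ck_on k S (\<lambda>x. a + l x)"
proof (cases k)
  case 0
  have "continuous_on S (\<lambda>x. a + l x)"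
    by (intro continuous_on_add continuous_on_const bounded_linear.continuous_on[OF assms(1)] continuous_on_id)
  then show ?thesis using 0 by simp
next
  case (Suc m)
  have "((\<lambda>x. a + l x) has_derivative l) (at x)" for x
    using has_derivative_add[OF has_derivative_const bounded_linear_imp_has_derivative[OF assms(1)]] by simp
  then show ?thesis
    unfolding Suc by (intro Ck_on_Suc_derivI[where f'="\<lambda>_. l"] assms Ck_on_const)
qed

lemma Ck_on_add:
  assumes "open S" "Ck_on k S f" "Ck_on k S g"
  shows "Ck_on k S (\<lambda>x. f x + g x)"
  using assms(2,3)
proof (induction k arbitrary: f g)
  case 0
  then show ?case by (auto intro: continuous_intros)
next
  case (Suc k)
  show ?case
    by (rule Ck_on_Suc_derivI[OF assms(1) has_derivative_add[OF Ck_on_has_derivative Ck_on_has_derivative]])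
      (use Suc in auto)
qed

lemma Ck_on_bilinear:
  assumes "bounded_bilinear p" "open S" "Ck_on k S f" "Ck_on k S g"
  shows "Ck_on k S (\<lambda>x. p (f x) (g x))"
  using assms(3,4)
proof (induction k arbitrary: f g)
  case 0
  then show ?case by (auto intro: bounded_bilinear.continuous_on[OF assms(1)])
next
  case (Suc k)
  show ?case
    by (rule Ck_on_Suc_derivI[OF assms(2)
          bounded_bilinear.FDERIV[OF assms(1) Ck_on_has_derivative Ck_on_has_derivative]])
      (use Suc in \<open>auto intro!: Ck_on_add[OF assms(2)] Suc.IH intro: Ck_on_SucD\<close>)
qed

lemmas Ck_on_mult = Ck_on_bilinear[OF bounded_bilinear_mult]
lemmas Ck_on_scaleR = Ck_on_bilinear[OF bounded_bilinear_scaleR]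

text \<open>Affine inner maps cover the two cases of composition that occur below: translations, and the
restriction of a function of two variables to a slice.\<close>

lemma Ck_on_compose_affine:
  assumes "open S" "Ck_on k T f" "bounded_linear l" "\<And>x. x \<in> S \<Longrightarrow> a + l x \<in> T"
  shows "Ck_on k S (\<lambda>x. f (a + l x))"
  using assms(2)
proof (induction k arbitrary: f)
  case 0
  have "continuous_on S (\<lambda>x. a + l x)"
    by (intro continuous_on_add continuous_on_const bounded_linear.continuous_on[OF assms(3)] continuous_on_id)
  then show ?case
    using 0 continuous_on_compose2[of T f S "\<lambda>x. a + l x"] assms(4) by force
next
  case (Suc k)
  have "((\<lambda>x. a + l x) has_derivative l) (at x)" for x
    using has_derivative_add[OF has_derivative_const bounded_linear_imp_has_derivative[OF assms(3)]] by simp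
  then have "((\<lambda>x. f (a + l x)) has_derivative (\<lambda>v. frechet_derivative f (at (a + l x)) (l v))) (at x)"
    if "x \<in> S" for x
    using has_derivative_compose[of "\<lambda>x. a + l x" l x UNIV f]
      Ck_on_has_derivative[OF Suc.prems assms(4)[OF that]] by blast
  moreover have "Ck_on k S (\<lambda>x. frechet_derivative f (at (a + l x)) (l v))" for v
    using Suc.IH[of "\<lambda>y. frechet_derivative f (at y) (l v)"] Suc.prems by simp
  ultimately show ?case
    by (rule Ck_on_Suc_derivI[OF assms(1)])
qed

lemma Ck_on_compose_real:
  fixes f :: "'a::real_normed_vector \<Rightarrow> real" and g :: "real \<Rightarrow> real"
  assumes "open S" "Ck_on k T g" "Ck_on k S f" "f ` S \<subseteq> T"
  shows "Ck_on k S (\<lambda>x. g (f x))"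
  using assms(2,3)
proof (induction k arbitrary: g)
  case 0
  then show ?case using continuous_on_compose2[of T g S f] assms(4) by simp
next
  case (Suc k)
  have "((\<lambda>x. g (f x)) has_derivative (\<lambda>v. frechet_derivative f (at x) v * frechet_derivative g (at (f x)) 1)) (at x)"
    if "x \<in> S" for x
  proof -
    have "f x \<in> T" using that assms(4) by auto
    note gd = Ck_on_has_derivative[OF Suc.prems(1) this]
    have "frechet_derivative g (at (f x)) w = w * frechet_derivative g (at (f x)) 1" for w
      using linear_cmul[OF has_derivative_linear[OF gd], of w 1] by simp
    then have "(\<lambda>v. frechet_derivative g (at (f x)) (frechet_derivative f (at x) v)) =
        (\<lambda>v. frechet_derivative f (at x) v * frechet_derivative g (at (f x)) 1)"
      by blast
    with has_derivative_compose[OF Ck_on_has_derivative[OF Suc.prems(2) that] gd] show ?thesis by argo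
  qed
  moreover have "Ck_on k S (\<lambda>x. frechet_derivative f (at x) v * frechet_derivative g (at (f x)) 1)" for v
  proof (rule Ck_on_mult[OF assms(1)])
    show "Ck_on k S (\<lambda>x. frechet_derivative f (at x) v)" using Suc.prems(2) by simp
    show "Ck_on k S (\<lambda>x. frechet_derivative g (at (f x)) 1)"
      using Suc.IH[of "\<lambda>y. frechet_derivative g (at y) 1"] Suc.prems(1) Ck_on_SucD[OF Suc.prems(2)] by simp
  qed
  ultimately show ?case by (rule Ck_on_Suc_derivI[OF assms(1)])
qed

lemma Ck_on_inverse: "Ck_on k (- {0::real}) inverse"
proof (induction k)
  case 0
  then show ?case by (auto intro!: continuous_intros)
next
  case (Suc k)
  show ?case
  proof (rule Ck_on_Suc_derivI)
    show "(inverse has_derivative (\<lambda>v. (inverse x * inverse x) * (- v))) (at x)" if "x \<in> - {0::real}" for x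
      using that by (auto intro!: derivative_eq_intros)
    show "Ck_on k (- {0::real}) (\<lambda>x. (inverse x * inverse x) * (- v))" for v
      by (intro Ck_on_mult Suc Ck_on_const) auto
  qed auto
qed

lemma Ck_on_sqrt: "Ck_on k {0::real<..} sqrt"
proof (induction k)
  case 0
  then show ?case by (auto intro!: continuous_intros)
next
  case (Suc k)
  show ?case
  proof (rule Ck_on_Suc_derivI)
    show "(sqrt has_derivative (\<lambda>v. inverse (sqrt x) * (v / 2))) (at x)" if "x \<in> {0<..}" for x
      using that by (auto intro!: derivative_eq_intros simp: field_simps)
    show "Ck_on k {0::real<..} (\<lambda>x. inverse (sqrt x) * (v / 2))" for v
      by (intro Ck_on_mult Ck_on_const Ck_on_compose_real[OF _ Ck_on_inverse Suc]) auto
  qed auto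
qed

lemma smooth_on_cong: "open S \<Longrightarrow> (\<And>x. x \<in> S \<Longrightarrow> f x = g x) \<Longrightarrow> smooth_on S f \<Longrightarrow> smooth_on S g"
  unfolding smooth_on_def using Ck_on_cong by blast

lemma smooth_on_imp_continuous_on: "smooth_on S f \<Longrightarrow> continuous_on S f"
  unfolding smooth_on_def using Ck_on.simps(1) by blast

lemma smooth_on_has_derivative:
  "smooth_on S f \<Longrightarrow> x \<in> S \<Longrightarrow> (f has_derivative frechet_derivative f (at x)) (at x)"
  unfolding smooth_on_def using Ck_on_has_derivative by blast

lemma smooth_on_frechet_derivative: "smooth_on S f \<Longrightarrow> smooth_on S (\<lambda>x. frechet_derivative f (at x) v)"
  unfolding smooth_on_def using Ck_on.simps(2) by blast

lemma smooth_on_const: "smooth_on S (\<lambda>x. c)"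
  unfolding smooth_on_def using Ck_on_const by blast

lemma smooth_on_affine: "bounded_linear l \<Longrightarrow> open S \<Longrightarrow> smooth_on S (\<lambda>x. a + l x)"
  unfolding smooth_on_def using Ck_on_affine by blast

lemma smooth_on_add: "open S \<Longrightarrow> smooth_on S f \<Longrightarrow> smooth_on S g \<Longrightarrow> smooth_on S (\<lambda>x. f x + g x)"
  by (simp add: smooth_on_def Ck_on_add)

lemma smooth_on_scaleR: "open S \<Longrightarrow> smooth_on S f \<Longrightarrow> smooth_on S g \<Longrightarrow> smooth_on S (\<lambda>x. f x *\<^sub>R g x)"
  by (simp add: smooth_on_def Ck_on_scaleR)

lemma smooth_on_mult:
  fixes f g :: "'a::real_normed_vector \<Rightarrow> real"
  shows "open S \<Longrightarrow> smooth_on S f \<Longrightarrow> smooth_on S g \<Longrightarrow> smooth_on S (\<lambda>x. f x * g x)"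
  by (simp add: smooth_on_def Ck_on_mult)

lemma smooth_on_sum:
  "open S \<Longrightarrow> (\<And>i. i \<in> I \<Longrightarrow> smooth_on S (f i)) \<Longrightarrow> smooth_on S (\<lambda>x. \<Sum>i\<in>I. f i x)"
  by (induction I rule: infinite_finite_induct) (auto intro!: smooth_on_const smooth_on_add)

lemma smooth_on_prod:
  fixes f :: "'i \<Rightarrow> 'a::real_normed_vector \<Rightarrow> real"
  shows "open S \<Longrightarrow> (\<And>i. i \<in> I \<Longrightarrow> smooth_on S (f i)) \<Longrightarrow> smooth_on S (\<lambda>x. \<Prod>i\<in>I. f i x)"
  by (induction I rule: infinite_finite_induct) (auto intro!: smooth_on_const smooth_on_mult)

lemma smooth_on_power:
  fixes f :: "'a::real_normed_vector \<Rightarrow> real"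
  shows "open S \<Longrightarrow> smooth_on S f \<Longrightarrow> smooth_on S (\<lambda>x. f x ^ n)"
  by (induction n) (auto intro!: smooth_on_const smooth_on_mult)

lemma smooth_on_inverse:
  fixes f :: "'a::real_normed_vector \<Rightarrow> real"
  assumes "open S" "smooth_on S f" "\<And>x. x \<in> S \<Longrightarrow> f x \<noteq> 0"
  shows "smooth_on S (\<lambda>x. inverse (f x))"
  unfolding smooth_on_def
  by (intro allI Ck_on_compose_real[OF assms(1) Ck_on_inverse])
    (use assms(2,3) in \<open>auto simp: smooth_on_def\<close>)

lemma smooth_on_divide:
  fixes f :: "'a::real_normed_vector \<Rightarrow> real"
  assumes "open S" "smooth_on S f" "smooth_on S g" "\<And>x. x \<in> S \<Longrightarrow> g x \<noteq> 0"
  shows "smooth_on S (\<lambda>x. f x / g x)"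
  unfolding divide_inverse by (intro smooth_on_mult smooth_on_inverse assms)

lemma smooth_on_sqrt:
  fixes f :: "'a::real_normed_vector \<Rightarrow> real"
  assumes "open S" "smooth_on S f" "\<And>x. x \<in> S \<Longrightarrow> 0 < f x"
  shows "smooth_on S (\<lambda>x. sqrt (f x))"
  unfolding smooth_on_def
  by (intro allI Ck_on_compose_real[OF assms(1) Ck_on_sqrt])
    (use assms(2,3) in \<open>auto simp: smooth_on_def\<close>)

lemma smooth_on_compose_affine:
  assumes "open S" "smooth_on T f" "bounded_linear l" "\<And>x. x \<in> S \<Longrightarrow> a + l x \<in> T"
  shows "smooth_on S (\<lambda>x. f (a + l x))"
  unfolding smooth_on_def
  by (intro allI Ck_on_compose_affine[OF assms(1) _ assms(3,4)]) (use assms(2) in \<open>auto simp: smooth_on_def\<close>)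

lemma smooth_on_det:
  fixes M :: "'a::real_normed_vector \<Rightarrow> real^'n^'n"
  assumes "open S" "\<And>i j. smooth_on S (\<lambda>x. M x $ i $ j)"
  shows "smooth_on S (\<lambda>x. det (M x))"
  unfolding det_def by (intro smooth_on_sum smooth_on_mult smooth_on_const smooth_on_prod assms)

section \<open>Change of variables for every finite index type\<close>

text \<open>A well-ordered copy of an arbitrary finite index type. The change of variables theorem concerns
\<open>real^'m\<close> with a well-ordered \<open>'m\<close>; it is carried over to every finite index type by renumbering the
coordinates, an operation that preserves both Lebesgue measure and determinants.\<close>

typedef ('n::finite) ordered_index = "{..<CARD('n)}"
  by (auto intro!: exI[of _ 0])

instantiation ordered_index :: (finite) "{finite, wellorder}"
begin

definition less_eq_ordered_index :: "'a ordered_index \<Rightarrow> 'a ordered_index \<Rightarrow> bool" where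
  "a \<le> b \<longleftrightarrow> Rep_ordered_index a \<le> Rep_ordered_index b"

definition less_ordered_index :: "'a ordered_index \<Rightarrow> 'a ordered_index \<Rightarrow> bool" where
  "a < b \<longleftrightarrow> Rep_ordered_index a < Rep_ordered_index b"

instance
proof
  show "finite (UNIV :: 'a ordered_index set)"
    unfolding type_definition.univ[OF type_definition_ordered_index] by simp
  show "P a" if "\<And>x. (\<And>y. y < x \<Longrightarrow> P y) \<Longrightarrow> P x" for P and a :: "'a ordered_index"
    by (induction "Rep_ordered_index a" arbitrary: a rule: less_induct)
      (metis less_ordered_index_def that)
qed (auto simp: less_eq_ordered_index_def less_ordered_index_def Rep_ordered_index_inject)

end

lemma ex_bij_ordered_index: "\<exists>\<beta> :: 'n::finite ordered_index \<Rightarrow> 'n. bij \<beta>"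
proof -
  have "CARD('n ordered_index) = CARD('n)"
    by (simp add: type_definition.card[OF type_definition_ordered_index])
  then show ?thesis by (metis finite_same_card_bij finite)
qed

lemma permutes_UNIV_iff_bij: "p permutes UNIV \<longleftrightarrow> bij p"
  by (simp add: permutes_def bij_iff)

lemma sign_conjugate:
  fixes \<beta> :: "'m::finite \<Rightarrow> 'n::finite"
  assumes \<beta>: "bij \<beta>" and p: "p permutes (UNIV :: 'm set)"
  shows "sign (\<beta> \<circ> p \<circ> inv \<beta>) = sign p"
proof -
  have "map_permutation UNIV \<beta> p = \<beta> \<circ> p \<circ> inv \<beta>"
    using \<beta> by (simp add: map_permutation_def restrict_id_def bij_def fun_eq_iff)
  then show ?thesis
    using sign_map_permutation[of \<beta> UNIV p] \<beta> p by (simp add: bij_def)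
qed

text \<open>Conjugation with \<open>\<beta>\<close> matches the permutations of the two index types and preserves signs, so the
Leibniz expansions of the two determinants agree term by term.\<close>

lemma det_reindex:
  fixes \<beta> :: "'m::finite \<Rightarrow> 'n::finite" and M :: "real^'n^'n"
  assumes \<beta>: "bij \<beta>"
  shows "det (\<chi> i j. M $ \<beta> i $ \<beta> j) = det M"
proof -
  let ?c = "\<lambda>p. \<beta> \<circ> p \<circ> inv \<beta>"
  have inv: "inv \<beta> (\<beta> i) = i" "\<beta> (inv \<beta> k) = k" for i k
    using \<beta> by (simp_all add: bij_is_inj bij_is_surj surj_f_inv_f)
  have bij: "bij_betw ?c {p. p permutes UNIV} {p. p permutes UNIV}"
  proof (rule bij_betwI[where g="\<lambda>q. inv \<beta> \<circ> q \<circ> \<beta>"])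
    show "?c \<in> {p. p permutes UNIV} \<rightarrow> {p. p permutes UNIV}"
      using \<beta> by (auto simp: permutes_UNIV_iff_bij intro!: bij_comp bij_imp_bij_inv)
    show "(\<lambda>q. inv \<beta> \<circ> q \<circ> \<beta>) \<in> {p. p permutes UNIV} \<rightarrow> {p. p permutes UNIV}"
      using \<beta> by (auto simp: permutes_UNIV_iff_bij intro!: bij_comp bij_imp_bij_inv)
  qed (auto simp: fun_eq_iff inv)
  have "(\<Prod>i\<in>UNIV. M $ \<beta> i $ \<beta> (p i)) = (\<Prod>k\<in>UNIV. M $ k $ ?c p k)" for p
    using prod.reindex_bij_betw[OF \<beta>, of "\<lambda>k. M $ k $ ?c p k"] by (simp add: inv)
  then show ?thesis
    unfolding det_def using \<beta>
    by (subst sum.reindex_bij_betw[OF bij, symmetric]) (simp add: sign_conjugate)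
qed

definition reindex :: "('m \<Rightarrow> 'n) \<Rightarrow> real^'n \<Rightarrow> real^'m" where
  "reindex \<beta> x = (\<chi> i. x $ \<beta> i)"

lemma bounded_linear_reindex: "bounded_linear (reindex (\<beta> :: 'm::finite \<Rightarrow> 'n::finite))"
  by (intro linear_linear[THEN iffD2] linearI) (auto simp: reindex_def vec_eq_iff)

lemma reindex_inv:
  assumes "bij \<beta>" shows "reindex \<beta> (reindex (inv \<beta>) x) = x" "reindex (inv \<beta>) (reindex \<beta> y) = y"
  using assms by (simp_all add: reindex_def vec_eq_iff bij_is_inj bij_is_surj surj_f_inv_f)

lemma prod_Basis_vec: "(\<Prod>b\<in>Basis. (x :: real^'n::finite) \<bullet> b) = (\<Prod>i\<in>UNIV. x $ i)"
proof -
  have "(Basis :: (real^'n) set) = range (\<lambda>i. axis i 1)"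
    by (auto simp: Basis_vec_def)
  moreover have "inj (\<lambda>i::'n. axis i (1::real))"
    by (auto simp: inj_def axis_eq_axis)
  ultimately have "(\<Prod>b\<in>Basis. x \<bullet> b) = (\<Prod>i\<in>UNIV. x \<bullet> axis i 1)"
    using prod.reindex[of "\<lambda>i. axis i (1::real)" "UNIV :: 'n set" "\<lambda>b. x \<bullet> b"] by simp
  then show ?thesis by (simp add: inner_axis)
qed

lemma distr_lborel_reindex:
  fixes \<beta> :: "'m::finite \<Rightarrow> 'n::finite"
  assumes \<beta>: "bij \<beta>"
  shows "distr lborel borel (reindex \<beta>) = lborel"
proof (rule lborel_eqI[symmetric])
  have [measurable]: "reindex \<beta> \<in> borel_measurable borel"
    by (simp add: bounded_linear_reindex linear_continuous_on borel_measurable_continuous_onI)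
  fix l u :: "real^'m"
  assume lu: "\<And>b. b \<in> Basis \<Longrightarrow> l \<bullet> b \<le> u \<bullet> b"
  have le: "l $ i \<le> u $ i" for i
    using lu[of "axis i 1"] by (simp add: inner_axis)
  let ?l = "reindex (inv \<beta>) l" and ?u = "reindex (inv \<beta>) u"
  have "(reindex \<beta> :: real^'n \<Rightarrow> _) -` box l u = box ?l ?u"
    using \<beta> by (auto simp: mem_box_cart reindex_def) (metis bij_inv_eq_iff)+
  then have "emeasure (distr lborel borel (reindex \<beta>)) (box l u) = emeasure lborel (box ?l ?u)"
    by (simp add: emeasure_distr)
  also have "\<dots> = (\<Prod>b\<in>Basis. (?u - ?l) \<bullet> b)"
    by (rule emeasure_lborel_box) (auto simp: Basis_vec_def inner_axis reindex_def le)
  also have "(\<Prod>b\<in>Basis. (?u - ?l) \<bullet> b) = (\<Prod>b\<in>Basis. (u - l) \<bullet> b)"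
    unfolding prod_Basis_vec
    by (subst prod.reindex_bij_betw[OF \<beta>, symmetric]) (use \<beta> in \<open>simp add: reindex_def bij_is_inj\<close>)
  finally show "emeasure (distr lborel borel (reindex \<beta>)) (box l u) = (\<Prod>b\<in>Basis. (u - l) \<bullet> b)" .
qed simp

lemma emeasure_image_wellorder:
  fixes g :: "real^'m::{finite,wellorder} \<Rightarrow> real^'m::_"
  assumes S: "S \<in> sets borel" and gS: "g ` S \<in> sets borel"
    and der: "\<And>x. x \<in> S \<Longrightarrow> (g has_derivative g' x) (at x within S)"
    and inj: "inj_on g S"
    and meas: "(\<lambda>x. indicator S x * \<bar>det (matrix (g' x))\<bar>) \<in> borel_measurable borel"
  shows "emeasure lborel (g ` S) = (\<integral>\<^sup>+x. ennreal (indicator S x * \<bar>det (matrix (g' x))\<bar>) \<partial>lborel)"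
    (is "_ = ?N")
proof -
  let ?h = "\<lambda>x. \<bar>det (matrix (g' x))\<bar>"
  have SL: "S \<in> sets lebesgue" using S by simp
  note image = has_measure_differentiable_image[OF SL der inj]
  have em: "emeasure lebesgue (g ` S) = emeasure lborel (g ` S)"
    using gS by simp
  show ?thesis
  proof (cases ?N rule: ennreal_cases)
    case (real m)
    have "((\<lambda>x. indicator S x * ?h x) has_integral m) UNIV"
      by (rule nn_integral_has_integral) (use meas real in auto)
    then have "(?h has_integral m) S"
      by (subst has_integral_restrict_UNIV[symmetric], elim has_integral_eq[rotated]) (simp add: indicator_def)
    with image have "g ` S \<in> lmeasurable" "measure lebesgue (g ` S) = m" by blast+
    then have "emeasure lebesgue (g ` S) = ennreal m"
      by (simp add: emeasure_eq_measure2)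
    with em real show ?thesis by simp
  next
    case top
    have "emeasure lborel (g ` S) = \<infinity>"
    proof (rule ccontr)
      assume "emeasure lborel (g ` S) \<noteq> \<infinity>"
      with em gS have "g ` S \<in> lmeasurable"
        by (auto simp: fmeasurable_def top.not_eq_extremum)
      with image obtain m where "(?h has_integral m) S" by blast
      then have "?N = ennreal m"
        by (intro nn_integral_has_integral_lebesgue) auto
      with top show False by simp
    qed
    with top show ?thesis by simp
  qed
qed

text \<open>Apply the result for well-ordered index types to the conjugate \<open>P \<circ> g \<circ> Q\<close> of \<open>g\<close> by the renumbering
\<open>P\<close> and its inverse \<open>Q\<close>.\<close>

lemma emeasure_differentiable_image:
  fixes g :: "real^'n::finite \<Rightarrow> real^'n"
  assumes S: "S \<in> sets borel" and gS: "g ` S \<in> sets borel"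
    and der: "\<And>x. x \<in> S \<Longrightarrow> (g has_derivative g' x) (at x within S)"
    and inj: "inj_on g S"
    and meas: "(\<lambda>x. indicator S x * \<bar>det (matrix (g' x))\<bar>) \<in> borel_measurable borel"
  shows "emeasure lborel (g ` S) = (\<integral>\<^sup>+x. ennreal (indicator S x * \<bar>det (matrix (g' x))\<bar>) \<partial>lborel)"
proof -
  obtain \<beta> :: "'n ordered_index \<Rightarrow> 'n" where \<beta>: "bij \<beta>"
    using ex_bij_ordered_index by blast
  define P where "P = reindex \<beta>"
  define Q where "Q = reindex (inv \<beta>)"
  have PQ: "P (Q x) = x" and QP: "Q (P y) = y" for x y
    using reindex_inv[OF \<beta>] by (auto simp: P_def Q_def)
  have Q\<beta>: "bij (inv \<beta>)" using \<beta> by (rule bij_imp_bij_inv)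
  have bP: "bounded_linear P" and bQ: "bounded_linear Q"
    by (simp_all add: P_def Q_def bounded_linear_reindex)
  have [measurable]: "P \<in> borel_measurable borel" "Q \<in> borel_measurable borel"
    using bP bQ by (simp_all add: linear_continuous_on borel_measurable_continuous_onI)
  have dQ: "distr lborel borel Q = lborel"
    unfolding Q_def by (rule distr_lborel_reindex[OF Q\<beta>])
  have image_P: "P ` T = Q -` T" for T
    using PQ QP by (auto simp: image_iff) metis
  have em: "emeasure lborel (P ` T) = emeasure lborel T" if "T \<in> sets borel" for T
    using emeasure_distr[of Q lborel borel T] that by (simp add: dQ image_P)
  let ?g = "\<lambda>z. P (g (Q z))" and ?g' = "\<lambda>z v. P (g' (Q z) (Q v))"
  have det: "det (matrix (?g' z)) = det (matrix (g' (Q z)))" for z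
  proof -
    have "Q (axis j 1) = axis (\<beta> j) 1" for j
      using \<beta> by (auto simp: Q_def reindex_def vec_eq_iff axis_def bij_is_inj bij_is_surj surj_f_inv_f)
    then have "matrix (?g' z) = (\<chi> i j. matrix (g' (Q z)) $ \<beta> i $ \<beta> j)"
      by (simp add: matrix_def P_def reindex_def)
    then show ?thesis using det_reindex[OF \<beta>] by simp
  qed
  have "emeasure lborel (g ` S) = emeasure lborel (P ` (g ` S))"
    using em gS by simp
  also have "P ` (g ` S) = ?g ` (P ` S)"
    by (simp add: image_image QP)
  also have "emeasure lborel \<dots> =
      (\<integral>\<^sup>+z. ennreal (indicator (P ` S) z * \<bar>det (matrix (?g' z))\<bar>) \<partial>lborel)"
  proof (rule emeasure_image_wellorder)
    show "P ` S \<in> sets borel"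
      using S measurable_sets[of Q borel borel S] by (simp add: image_P)
    show "?g ` P ` S \<in> sets borel"
      using gS measurable_sets[of Q borel borel "g ` S"] by (simp add: image_image QP flip: image_P)
    show "inj_on ?g (P ` S)"
      using inj by (auto simp: inj_on_def QP) (metis QP)
    show "(?g has_derivative ?g' z) (at z within P ` S)" if "z \<in> P ` S" for z
    proof -
      have "Q z \<in> S" "Q ` P ` S = S" using that by (auto simp: image_P QP PQ image_iff) (metis QP PQ)
      then have "(g has_derivative g' (Q z)) (at (Q z) within Q ` P ` S)" using der by simp
      from has_derivative_in_compose[OF bounded_linear_imp_has_derivative[OF bQ] this]
      show ?thesis by (rule bounded_linear.has_derivative[OF bP])
    qed
    have "(\<lambda>z. indicator S (Q z) * \<bar>det (matrix (g' (Q z)))\<bar>) \<in> borel_measurable borel"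
      using measurable_compose[OF \<open>Q \<in> borel_measurable borel\<close> meas] by simp
    then show "(\<lambda>z. indicator (P ` S) z * \<bar>det (matrix (?g' z))\<bar>) \<in> borel_measurable borel"
      by (simp add: det image_P indicator_def)
  qed
  also have "\<dots> = (\<integral>\<^sup>+z. ennreal (indicator S (Q z) * \<bar>det (matrix (g' (Q z)))\<bar>) \<partial>lborel)"
    by (simp add: det image_P indicator_def)
  also have "\<dots> = (\<integral>\<^sup>+x. ennreal (indicator S x * \<bar>det (matrix (g' x))\<bar>) \<partial>lborel)"
    using nn_integral_distr[of Q lborel borel "\<lambda>x. ennreal (indicator S x * \<bar>det (matrix (g' x))\<bar>)"] meas
    by (simp add: dQ)
  finally show ?thesis .
qed

text \<open>The formula for the measure of images says that two measures on \<open>g ` S\<close> coincide: Lebesgue measure, and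
the image under \<open>g\<close> of the measure with density \<open>\<bar>det\<bar>\<close>. Integrating against both gives the claim for
every measurable integrand at once.\<close>

lemma nn_integral_change_of_variables:
  fixes g :: "real^'n::finite \<Rightarrow> real^'n" and f :: "real^'n \<Rightarrow> ennreal"
  assumes S: "S \<in> sets borel" and gS: "g ` S \<in> sets borel"
    and der: "\<And>x. x \<in> S \<Longrightarrow> (g has_derivative g' x) (at x within S)"
    and inj: "inj_on g S"
    and meas: "(\<lambda>x. indicator S x * \<bar>det (matrix (g' x))\<bar>) \<in> borel_measurable borel"
    and f: "f \<in> borel_measurable borel"
  shows "(\<integral>\<^sup>+y\<in>g ` S. f y \<partial>lborel) = (\<integral>\<^sup>+x\<in>S. ennreal \<bar>det (matrix (g' x))\<bar> * f (g x) \<partial>lborel)"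
proof -
  let ?d = "\<lambda>x. \<bar>det (matrix (g' x))\<bar>"
  define M where "M = density (restrict_space lborel S) (\<lambda>x. ennreal (?d x))"
  have [measurable]: "S \<in> sets borel" "f \<in> borel_measurable borel" by fact+
  have cont: "continuous_on S g"
    using der has_derivative_continuous continuous_on_eq_continuous_within by blast
  have gm: "g \<in> restrict_space borel S \<rightarrow>\<^sub>M restrict_space borel (g ` S)"
    by (rule measurable_restrict_space2[OF _ borel_measurable_continuous_on_restrict[OF cont]])
      (auto simp: space_restrict_space)
  have dm: "?d \<in> borel_measurable (restrict_space borel S)"
    using meas S by (subst borel_measurable_restrict_space_iff) (auto simp: mult.commute)
  have sM: "sets M = sets (restrict_space borel S)"
    by (simp add: M_def sets_restrict_space)
  have gM: "g \<in> M \<rightarrow>\<^sub>M restrict_space borel (g ` S)"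
    using gm measurable_cong_sets[OF sM refl] by blast
  have "distr M (restrict_space borel (g ` S)) g = restrict_space lborel (g ` S)"
  proof (rule measure_eqI)
    show "sets (distr M (restrict_space borel (g ` S)) g) = sets (restrict_space lborel (g ` S))"
      by (simp add: sets_restrict_space)
    fix B assume "B \<in> sets (distr M (restrict_space borel (g ` S)) g)"
    then have B: "B \<in> sets (restrict_space borel (g ` S))" by simp
    then have B': "B \<subseteq> g ` S" "B \<in> sets borel"
      using gS by (auto simp: sets_restrict_space_iff)
    let ?A = "g -` B \<inter> S"
    have A: "?A \<in> sets borel"
      using measurable_sets[OF gm B] S by (simp add: sets_restrict_space_iff space_restrict_space)
    have gA: "g ` ?A = B" using B' by auto
    have "emeasure (distr M (restrict_space borel (g ` S)) g) B = emeasure M ?A"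
      using B gM by (subst emeasure_distr) (auto simp: M_def space_restrict_space)
    also have "\<dots> = (\<integral>\<^sup>+x\<in>?A. ennreal (?d x) \<partial>restrict_space lborel S)"
      unfolding M_def using dm A S
      by (intro emeasure_density) (auto simp: sets_restrict_space_iff cong: measurable_cong_sets)
    also have "\<dots> = (\<integral>\<^sup>+x. ennreal (indicator ?A x * ?d x) \<partial>lborel)"
      using S by (subst nn_integral_restrict_space) (auto intro!: nn_integral_cong simp: indicator_def)
    also have "\<dots> = emeasure lborel (g ` ?A)"
    proof (rule emeasure_differentiable_image[symmetric])
      show "g ` ?A \<in> sets borel" using gA B' by simp
      show "(g has_derivative g' x) (at x within ?A)" if "x \<in> ?A" for x
        using der that has_derivative_subset by (metis IntD2 inf_le2)
      show "inj_on g ?A" using inj by (auto simp: inj_on_def)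
      have "(\<lambda>x. indicator ?A x * ?d x) = (\<lambda>x. indicator ?A x * (indicator S x * ?d x))"
        by (auto simp: indicator_def)
      then show "(\<lambda>x. indicator ?A x * ?d x) \<in> borel_measurable borel"
        using A meas by simp
    qed (rule A)
    also have "\<dots> = emeasure (restrict_space lborel (g ` S)) B"
      using B' gS by (simp add: gA emeasure_restrict_space)
    finally show "emeasure (distr M (restrict_space borel (g ` S)) g) B =
        emeasure (restrict_space lborel (g ` S)) B" .
  qed
  then have "(\<integral>\<^sup>+y\<in>g ` S. f y \<partial>lborel) = (\<integral>\<^sup>+y. f y \<partial>distr M (restrict_space borel (g ` S)) g)"
    using gS by (simp add: nn_integral_restrict_space)
  also have "\<dots> = (\<integral>\<^sup>+x. f (g x) \<partial>M)"
    using gM by (intro nn_integral_distr) (auto intro: measurable_restrict_space1)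
  also have "\<dots> = (\<integral>\<^sup>+x. ennreal (?d x) * f (g x) \<partial>restrict_space lborel S)"
  proof -
    have "(\<lambda>x. f (g x)) \<in> borel_measurable (restrict_space borel S)"
      using measurable_compose[OF gm measurable_restrict_space1[OF f]] by simp
    then show ?thesis
      unfolding M_def using dm
      by (intro nn_integral_density) (auto cong: measurable_cong_sets simp: sets_restrict_space)
  qed
  also have "\<dots> = (\<integral>\<^sup>+x\<in>S. ennreal (?d x) * f (g x) \<partial>lborel)"
    using S by (simp add: nn_integral_restrict_space)
  finally show ?thesis .
qed

lemma measurable_vec_lambda:
  fixes f :: "'a \<Rightarrow> 'n::finite \<Rightarrow> real"
  assumes "\<And>i. (\<lambda>x. f x i) \<in> borel_measurable M"
  shows "(\<lambda>x. \<chi> i. f x i) \<in> borel_measurable M"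
  using assms by (subst borel_measurable_euclidean_space) (auto simp: Basis_vec_def inner_axis)

lemma lborel_vec:
  "distr (Pi\<^sub>M UNIV (\<lambda>_. lborel)) borel (\<lambda>u. \<chi> i. u i) = (lborel :: (real^'n::finite) measure)"
proof (rule lborel_eqI[symmetric])
  interpret product_sigma_finite "\<lambda>_::'n. lborel :: real measure" ..
  have [measurable]: "(\<lambda>u. \<chi> i::'n. u i) \<in> borel_measurable (Pi\<^sub>M UNIV (\<lambda>_. lborel :: real measure))"
    
    using measurable_component_singleton[of _ UNIV "\<lambda>_. lborel :: real measure"]
    by (intro measurable_vec_lambda[of "\<lambda>u. u"]) simp
  fix l u :: "real^'n"
  assume lu: "\<And>b. b \<in> Basis \<Longrightarrow> l \<bullet> b \<le> u \<bullet> b"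
  have le: "l $ i \<le> u $ i" for i
    using lu[of "axis i 1"] by (simp add: inner_axis)
  have "(\<lambda>u. \<chi> i. u i) -` box l u \<inter> space (Pi\<^sub>M UNIV (\<lambda>_. lborel)) = (\<Pi>\<^sub>E i\<in>UNIV. {l $ i<..<u $ i})"
    by (auto simp: mem_box_cart space_PiM PiE_def Pi_def)
  then have "emeasure (distr (Pi\<^sub>M UNIV (\<lambda>_. lborel)) borel (\<lambda>u. \<chi> i. u i)) (box l u) =
      (\<Prod>i\<in>UNIV. emeasure lborel {l $ i<..<u $ i})"
    by (simp add: emeasure_distr emeasure_PiM)
  also have "\<dots> = (\<Prod>i\<in>UNIV. ennreal ((u - l) $ i))"
    using le by simp
  also have "\<dots> = (\<Prod>b\<in>Basis. (u - l) \<bullet> b)"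
    unfolding prod_Basis_vec using le by (intro prod_ennreal) simp
  finally show "emeasure (distr (Pi\<^sub>M UNIV (\<lambda>_. lborel)) borel (\<lambda>u. \<chi> i. u i)) (box l u) =
      (\<Prod>b\<in>Basis. (u - l) \<bullet> b)" .
qed simp

lemma measurable_hyperplane_embedding:
  "(\<lambda>u. \<chi> j. if j = k then 0 else u j) \<in> borel_measurable (Pi\<^sub>M (UNIV - {k::'n::finite}) (\<lambda>_. lborel :: real measure))"
proof (rule measurable_vec_lambda[of "\<lambda>u j. if j = k then 0 else u j"])
  have "(\<lambda>u. u j) \<in> borel_measurable (Pi\<^sub>M (UNIV - {k}) (\<lambda>_. lborel :: real measure))" if "j \<noteq> k" for j
    using measurable_component_singleton[of j "UNIV - {k}" "\<lambda>_. lborel :: real measure"] that by simp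
  then show "(\<lambda>u. if j = k then 0 else u j) \<in> borel_measurable (Pi\<^sub>M (UNIV - {k}) (\<lambda>_. lborel :: real measure))" for j
    by (cases "j = k") simp_all
qed

text \<open>Fubini's theorem, with the \<open>k\<close>-th coordinate singled out.\<close>

lemma nn_integral_lborel_hyperplane:
  fixes f :: "real^'n::finite \<Rightarrow> ennreal"
  assumes f[measurable]: "f \<in> borel_measurable borel"
  shows "(\<integral>\<^sup>+z. f z \<partial>lborel) = (\<integral>\<^sup>+u. (\<integral>\<^sup>+r. f (u + r *\<^sub>R axis k 1) \<partial>lborel) \<partial>hyperplane_lborel k)"
proof -
  interpret product_sigma_finite "\<lambda>_::'n. lborel :: real measure" ..
  have comp: "(\<lambda>u. u i) \<in> borel_measurable (Pi\<^sub>M I (\<lambda>_. lborel :: real measure))" if "i \<in> I" for I and i :: 'n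
    using measurable_component_singleton[OF that, of "\<lambda>_. lborel :: real measure"] by simp
  have [measurable]: "(\<lambda>u. \<chi> i::'n. u i) \<in> borel_measurable (Pi\<^sub>M UNIV (\<lambda>_. lborel :: real measure))"
    by (rule measurable_vec_lambda[of "\<lambda>u. u"]) (simp add: comp)
  note measurable_hyperplane_embedding[of k, measurable]
  have "(\<integral>\<^sup>+z. f z \<partial>lborel) = (\<integral>\<^sup>+u. f (\<chi> i. u i) \<partial>Pi\<^sub>M UNIV (\<lambda>_. lborel))"
    by (subst lborel_vec[symmetric]) (simp add: nn_integral_distr)
  also have "\<dots> = (\<integral>\<^sup>+u. f (\<chi> i. u i) \<partial>Pi\<^sub>M (insert k (UNIV - {k})) (\<lambda>_. lborel))"
    by (simp add: insert_absorb)
  also have "\<dots> = (\<integral>\<^sup>+x. (\<integral>\<^sup>+r. f (\<chi> i. (x(k := r)) i) \<partial>lborel) \<partial>Pi\<^sub>M (UNIV - {k}) (\<lambda>_. lborel))"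
    by (rule product_nn_integral_insert) (simp_all add: insert_absorb)
  also have "\<dots> = (\<integral>\<^sup>+x. (\<integral>\<^sup>+r. f ((\<chi> j. if j = k then 0 else x j) + r *\<^sub>R axis k 1) \<partial>lborel)
      \<partial>Pi\<^sub>M (UNIV - {k}) (\<lambda>_. lborel))"
    by (intro nn_integral_cong arg_cong[where f=f]) (auto simp: vec_eq_iff axis_def)
  also have "\<dots> = (\<integral>\<^sup>+u. (\<integral>\<^sup>+r. f (u + r *\<^sub>R axis k 1) \<partial>lborel) \<partial>hyperplane_lborel k)"
    unfolding hyperplane_lborel_def by (subst nn_integral_distr) simp_all
  finally show ?thesis .
qed

lemma lborel_linear:
  fixes L :: "real^'n::finite \<Rightarrow> real^'n"
  assumes "linear L" "inj L"
  shows "lborel = density (distr lborel borel L) (\<lambda>_. ennreal \<bar>det (matrix L)\<bar>)"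
proof (rule measure_eqI)
  have bl: "bounded_linear L" using assms by (simp add: linear_linear)
  have [measurable]: "L \<in> borel_measurable borel"
    using bl by (simp add: linear_continuous_on borel_measurable_continuous_onI)
  have surj: "range L = UNIV" using assms linear_injective_imp_surjective by blast
  fix B :: "(real^'n) set" assume "B \<in> sets lborel"
  then have [measurable]: "B \<in> sets borel" by simp
  have "emeasure lborel B = (\<integral>\<^sup>+y\<in>range L. indicator B y \<partial>lborel)"
    by (simp add: surj)
  also have "\<dots> = (\<integral>\<^sup>+x\<in>UNIV. ennreal \<bar>det (matrix L)\<bar> * indicator B (L x) \<partial>lborel)"
    by (rule nn_integral_change_of_variables)
      (use assms surj bl in \<open>auto intro: bounded_linear_imp_has_derivative\<close>)
  also have "\<dots> = emeasure (density (distr lborel borel L) (\<lambda>_. ennreal \<bar>det (matrix L)\<bar>)) B"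
    by (simp add: emeasure_density nn_integral_distr)
  finally show "emeasure lborel B = emeasure (density (distr lborel borel L) (\<lambda>_. ennreal \<bar>det (matrix L)\<bar>)) B" .
qed simp

section \<open>Symmetry of second derivatives and differentiation under the integral sign\<close>

lemma smooth_on_line_derivative:
  fixes f :: "'a::real_normed_vector \<Rightarrow> real"
  assumes "smooth_on S f" "p + t *\<^sub>R v \<in> S"
  shows "((\<lambda>t. f (p + t *\<^sub>R v)) has_real_derivative frechet_derivative f (at (p + t *\<^sub>R v)) v) (at t)"
proof -
  have "((\<lambda>t. p + t *\<^sub>R v) has_derivative (\<lambda>s. s *\<^sub>R v)) (at t)"
    by (auto intro!: derivative_eq_intros)
  from has_derivative_compose[OF this smooth_on_has_derivative[OF assms]]
  show ?thesis
    unfolding has_field_derivative_def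
    using linear_cmul[OF has_derivative_linear[OF smooth_on_has_derivative[OF assms]], of _ v]
    by (simp add: mult_commute_abs)
qed

text \<open>The mean value theorem in direction \<open>a\<close>, then in direction \<open>b\<close>. The left hand side of the equation is
symmetric in \<open>a\<close> and \<open>b\<close>, which yields the symmetry of second derivatives in the limit \<open>s \<rightarrow> 0\<close>.\<close>

lemma second_difference_mean_value:
  fixes f :: "'a::real_normed_vector \<Rightarrow> real"
  assumes "smooth_on S f" "0 < s"
    and in_S: "\<And>\<sigma> \<tau>. 0 \<le> \<sigma> \<Longrightarrow> \<sigma> \<le> s \<Longrightarrow> 0 \<le> \<tau> \<Longrightarrow> \<tau> \<le> s \<Longrightarrow> x + \<sigma> *\<^sub>R a + \<tau> *\<^sub>R b \<in> S"
  obtains \<xi> \<eta> where "0 \<le> \<xi>" "\<xi> \<le> s" "0 \<le> \<eta>" "\<eta> \<le> s"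
    "f (x + s *\<^sub>R a + s *\<^sub>R b) - f (x + s *\<^sub>R a) - f (x + s *\<^sub>R b) + f x =
      s * s * frechet_derivative (\<lambda>y. frechet_derivative f (at y) a) (at (x + \<xi> *\<^sub>R a + \<eta> *\<^sub>R b)) b"
proof -
  let ?Da = "\<lambda>y. frechet_derivative f (at y) a"
  have "((\<lambda>t. f ((x + s *\<^sub>R b) + t *\<^sub>R a) - f (x + t *\<^sub>R a)) has_real_derivative
      ?Da ((x + s *\<^sub>R b) + t *\<^sub>R a) - ?Da (x + t *\<^sub>R a)) (at t)" if "0 \<le> t" "t \<le> s" for t
    using in_S[of t s] in_S[of t 0] that assms(2)
    by (intro DERIV_diff smooth_on_line_derivative[OF assms(1)]) (simp_all add: algebra_simps)
  from MVT2[OF \<open>0 < s\<close> this] obtain \<xi> where \<xi>: "0 < \<xi>" "\<xi> < s"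
    "(f ((x + s *\<^sub>R b) + s *\<^sub>R a) - f (x + s *\<^sub>R a)) - (f ((x + s *\<^sub>R b) + 0 *\<^sub>R a) - f (x + 0 *\<^sub>R a)) =
      (s - 0) * (?Da ((x + s *\<^sub>R b) + \<xi> *\<^sub>R a) - ?Da (x + \<xi> *\<^sub>R a))"
    by blast
  have "((\<lambda>t. ?Da ((x + \<xi> *\<^sub>R a) + t *\<^sub>R b)) has_real_derivative
      frechet_derivative ?Da (at ((x + \<xi> *\<^sub>R a) + t *\<^sub>R b)) b) (at t)" if "0 \<le> t" "t \<le> s" for t
    using in_S[of \<xi> t] that \<xi>
    by (intro smooth_on_line_derivative[OF smooth_on_frechet_derivative[OF assms(1)]]) (simp add: algebra_simps)
  from MVT2[OF \<open>0 < s\<close> this] obtain \<eta> where \<eta>: "0 < \<eta>" "\<eta> < s"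
    "?Da ((x + \<xi> *\<^sub>R a) + s *\<^sub>R b) - ?Da ((x + \<xi> *\<^sub>R a) + 0 *\<^sub>R b) =
      (s - 0) * frechet_derivative ?Da (at ((x + \<xi> *\<^sub>R a) + \<eta> *\<^sub>R b)) b"
    by blast
  have "f (x + s *\<^sub>R a + s *\<^sub>R b) - f (x + s *\<^sub>R a) - f (x + s *\<^sub>R b) + f x =
      s * (?Da ((x + \<xi> *\<^sub>R a) + s *\<^sub>R b) - ?Da ((x + \<xi> *\<^sub>R a) + 0 *\<^sub>R b))"
    using \<xi>(3) by (simp add: algebra_simps)
  then show ?thesis
    using that[of \<xi> \<eta>] \<xi>(1,2) \<eta> by simp
qed

lemma smooth_on_derivatives_commute:
  fixes f :: "'a::real_normed_vector \<Rightarrow> real"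
  assumes "open S" "smooth_on S f" "x \<in> S"
  shows "frechet_derivative (\<lambda>y. frechet_derivative f (at y) a) (at x) b =
    frechet_derivative (\<lambda>y. frechet_derivative f (at y) b) (at x) a" (is "?A x = ?B x")
proof (rule ccontr)
  assume ne: "?A x \<noteq> ?B x"
  define e where "e = \<bar>?A x - ?B x\<bar> / 2"
  have e: "0 < e" using ne by (simp add: e_def)
  have "isCont ?A x" "isCont ?B x"
    using assms smooth_on_frechet_derivative smooth_on_imp_continuous_on continuous_on_eq_continuous_at by blast+
  then obtain dA dB where d: "0 < dA" "\<And>y. dist y x < dA \<Longrightarrow> dist (?A y) (?A x) < e"
    "0 < dB" "\<And>y. dist y x < dB \<Longrightarrow> dist (?B y) (?B x) < e"
    using e unfolding continuous_at_eps_delta by metis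
  obtain dS where dS: "0 < dS" "ball x dS \<subseteq> S"
    using assms openE by blast
  define \<delta> where "\<delta> = min dS (min dA dB)"
  have \<delta>: "0 < \<delta>" using d dS by (simp add: \<delta>_def)
  \<comment> \<open>so small that the parallelogram spanned by \<open>s a\<close> and \<open>s b\<close> at \<open>x\<close> lies in the \<open>\<delta>\<close>-ball\<close>
  define s where "s = \<delta> / (norm a + norm b + 1)"
  have den: "0 < norm a + norm b + 1" using norm_ge_zero[of a] norm_ge_zero[of b] by linarith
  have s: "0 < s" using \<delta> den by (simp add: s_def)
  have near: "dist (x + \<sigma> *\<^sub>R u + \<tau> *\<^sub>R v) x < \<delta>"
    if "0 \<le> \<sigma>" "\<sigma> \<le> s" "0 \<le> \<tau>" "\<tau> \<le> s" "norm u + norm v = norm a + norm b" for \<sigma> \<tau> u v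
  proof -
    have "dist (x + \<sigma> *\<^sub>R u + \<tau> *\<^sub>R v) x \<le> \<sigma> * norm u + \<tau> * norm v"
      using norm_triangle_ineq[of "\<sigma> *\<^sub>R u" "\<tau> *\<^sub>R v"] that by (simp add: dist_norm algebra_simps)
    also have "\<dots> \<le> s * norm u + s * norm v"
      using that by (intro add_mono mult_right_mono) auto
    also have "\<dots> = s * (norm a + norm b)" using that by (metis distrib_left)
    also have "\<dots> < s * (norm a + norm b + 1)" using s by simp
    also have "\<dots> = \<delta>" using den by (simp add: s_def)
    finally show ?thesis .
  qed
  have inS: "x + \<sigma> *\<^sub>R u + \<tau> *\<^sub>R v \<in> S"
    if "0 \<le> \<sigma>" "\<sigma> \<le> s" "0 \<le> \<tau>" "\<tau> \<le> s" "norm u + norm v = norm a + norm b" for \<sigma> \<tau> u v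
    using near[OF that] dS by (auto simp: \<delta>_def dist_commute mem_ball subset_iff)
  obtain \<xi> \<eta> where 1: "0 \<le> \<xi>" "\<xi> \<le> s" "0 \<le> \<eta>" "\<eta> \<le> s"
    "f (x + s *\<^sub>R a + s *\<^sub>R b) - f (x + s *\<^sub>R a) - f (x + s *\<^sub>R b) + f x = s * s * ?A (x + \<xi> *\<^sub>R a + \<eta> *\<^sub>R b)"
    using second_difference_mean_value[OF assms(2) s inS, of a b] by auto
  obtain \<xi>' \<eta>' where 2: "0 \<le> \<xi>'" "\<xi>' \<le> s" "0 \<le> \<eta>'" "\<eta>' \<le> s"
    "f (x + s *\<^sub>R b + s *\<^sub>R a) - f (x + s *\<^sub>R b) - f (x + s *\<^sub>R a) + f x = s * s * ?B (x + \<xi>' *\<^sub>R b + \<eta>' *\<^sub>R a)"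
    using second_difference_mean_value[OF assms(2) s inS, of b a] by (auto simp: add.commute)
  have "x + s *\<^sub>R b + s *\<^sub>R a = x + s *\<^sub>R a + s *\<^sub>R b" by simp
  with 2(5) have "f (x + s *\<^sub>R a + s *\<^sub>R b) - f (x + s *\<^sub>R b) - f (x + s *\<^sub>R a) + f x =
      s * s * ?B (x + \<xi>' *\<^sub>R b + \<eta>' *\<^sub>R a)"
    by (simp only:)
  with 1(5) have "s * s * ?A (x + \<xi> *\<^sub>R a + \<eta> *\<^sub>R b) = s * s * ?B (x + \<xi>' *\<^sub>R b + \<eta>' *\<^sub>R a)"
    by linarith
  then have "?A (x + \<xi> *\<^sub>R a + \<eta> *\<^sub>R b) = ?B (x + \<xi>' *\<^sub>R b + \<eta>' *\<^sub>R a)"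
    using s by simp
  moreover have "dist (?A (x + \<xi> *\<^sub>R a + \<eta> *\<^sub>R b)) (?A x) < e"
    using near[OF 1(1-4), of a b] by (intro d(2)) (simp add: \<delta>_def)
  moreover have "dist (?B (x + \<xi>' *\<^sub>R b + \<eta>' *\<^sub>R a)) (?B x) < e"
    using near[OF 2(1-4), of b a] by (intro d(4)) (simp add: \<delta>_def add.commute)
  ultimately show False
    unfolding dist_real_def e_def by (smt (verit) field_sum_of_halves)
qed

lemma set_integrable_continuous_compact:
  fixes f :: "'b::euclidean_space \<Rightarrow> real"
  shows "compact K \<Longrightarrow> continuous_on K f \<Longrightarrow> set_integrable lborel K f"
  unfolding set_integrable_def by (rule borel_integrable_compact)

lemma set_integral_le_measure:
  fixes f :: "'b::euclidean_space \<Rightarrow> real"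
  assumes K: "compact K" and cont: "continuous_on K f" and le: "\<And>t. t \<in> K \<Longrightarrow> \<bar>f t\<bar> \<le> c"
  shows "\<bar>LINT t:K|lborel. f t\<bar> \<le> c * measure lborel K"
proof -
  have "\<bar>LINT t:K|lborel. f t\<bar> \<le> (LINT t:K|lborel. \<bar>f t\<bar>)"
    using set_integral_norm_bound[OF set_integrable_continuous_compact[OF K cont]] by simp
  also have "\<dots> \<le> (LINT t:K|lborel. c)"
    using K cont le by (intro set_integral_mono set_integrable_continuous_compact continuous_intros) auto
  also have "\<dots> = c * measure lborel K"
    using K by (simp add: set_lebesgue_integral_def compact_imp_closed mult.commute)
  finally show ?thesis .
qed

lemma continuous_on_parametric_integral:
  fixes f :: "'a::euclidean_space \<times> 'b::euclidean_space \<Rightarrow> real"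
  assumes K: "compact K" and cont: "continuous_on (U \<times> K) f"
  shows "continuous_on U (\<lambda>x. LINT t:K|lborel. f (x, t))"
proof (subst continuous_on_iff, intro ballI allI impI)
  fix x e assume x: "x \<in> U" and e: "(0::real) < e"
  define m where "m = measure lborel K"
  have m: "0 \<le> m" by (simp add: m_def)
  define e' where "e' = e / (2 * (m + 1))"
  have e': "0 < e'" using e m by (simp add: e'_def)
  obtain X where X: "x \<in> X" "open X" "\<forall>y\<in>X \<inter> U. \<forall>t\<in>K. dist (f (y, t)) (f (x, t)) \<le> e'"
    by (rule continuous_on_prod_compactE[OF cont K x e'])
  obtain d where d: "0 < d" "ball x d \<subseteq> X" using openE[OF X(2,1)] by blast
  have cK: "continuous_on K (\<lambda>t. f (y, t))" if "y \<in> U" for y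
    by (rule continuous_on_compose2[OF cont]) (use that in \<open>auto intro!: continuous_intros\<close>)
  show "\<exists>d>0. \<forall>y\<in>U. dist y x < d \<longrightarrow> dist (LINT t:K|lborel. f (y, t)) (LINT t:K|lborel. f (x, t)) < e"
  proof (intro exI conjI ballI impI)
    fix y assume y: "y \<in> U" "dist y x < d"
    then have "y \<in> X \<inter> U" using d by (auto simp: dist_commute)
    then have "\<bar>LINT t:K|lborel. f (y, t) - f (x, t)\<bar> \<le> e' * m"
      unfolding m_def using X(3) x y
      by (intro set_integral_le_measure[OF K] continuous_on_diff cK) (auto simp: dist_real_def)
    also have "e' * m \<le> e' * (m + 1)" using e' by simp
    also have "\<dots> < e" unfolding e'_def using e m by (simp add: pos_divide_less_eq)
    finally show "dist (LINT t:K|lborel. f (y, t)) (LINT t:K|lborel. f (x, t)) < e"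
      using set_integral_diff[OF set_integrable_continuous_compact[OF K cK[OF y(1)]]
          set_integrable_continuous_compact[OF K cK[OF x]]]
      by (simp add: dist_real_def)
  qed (rule d)
qed

text \<open>On a compact set \<open>K\<close> the gradient in the parameter is continuous uniformly in \<open>t\<close>, so by the mean value
theorem the error of the linear approximation of \<open>f (y, t)\<close> is at most \<open>e' * norm (y - x)\<close> for all \<open>t\<close>
simultaneously, and this estimate survives integration over \<open>K\<close>.\<close>

lemma has_derivative_parametric_integral:
  fixes f :: "'a::euclidean_space \<times> 'b::euclidean_space \<Rightarrow> real"
  assumes U: "open U" and KV: "compact K" "K \<subseteq> V" and f: "smooth_on (U \<times> V) f" and x: "x \<in> U"
  shows "((\<lambda>x. LINT t:K|lborel. f (x, t)) has_derivative
    (\<lambda>v. LINT t:K|lborel. frechet_derivative f (at (x, t)) (v, 0))) (at x)"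
proof -
  let ?D = "\<lambda>v z. frechet_derivative f (at z) (v, 0)"
  have cD: "continuous_on (U \<times> K) (?D v)" for v
    using smooth_on_imp_continuous_on[OF smooth_on_frechet_derivative[OF f]] KV(2)
    by (meson Sigma_mono continuous_on_subset order_refl)
  have cf: "continuous_on (U \<times> K) f"
    using smooth_on_imp_continuous_on[OF f] KV(2) by (meson Sigma_mono continuous_on_subset order_refl)
  have slice: "continuous_on K (\<lambda>t. h (y, t))" if "y \<in> U" "continuous_on (U \<times> K) h" for y and h :: "_ \<Rightarrow> real"
    by (rule continuous_on_compose2[OF that(2)]) (use that(1) in \<open>auto intro!: continuous_intros\<close>)
  have der: "(f has_derivative frechet_derivative f (at (y, t))) (at (y, t))" if "y \<in> U" "t \<in> K" for y t
    using smooth_on_has_derivative[OF f] that KV(2) by blast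
  have lin: "linear (\<lambda>v. ?D v (y, t))" if "y \<in> U" "t \<in> K" for y t
    using linear_compose[OF _ has_derivative_linear[OF der[OF that]], of "\<lambda>v. (v, 0)"]
    by (simp add: o_def linear_iff)
  \<comment> \<open>the gradient in the parameter as a vector, so that one uniformity estimate serves all directions\<close>
  define grad where "grad z = (\<Sum>b\<in>Basis. ?D b z *\<^sub>R b)" for z
  have grad: "?D v (y, t) = grad (y, t) \<bullet> v" if "y \<in> U" "t \<in> K" for v y t
  proof -
    have "?D v (y, t) = ?D (\<Sum>b\<in>Basis. (v \<bullet> b) *\<^sub>R b) (y, t)" by (simp add: euclidean_representation)
    also have "\<dots> = (\<Sum>b\<in>Basis. (v \<bullet> b) * ?D b (y, t))"
      by (subst linear_sum[OF lin[OF that]]) (simp add: linear_cmul[OF lin[OF that]])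
    also have "\<dots> = grad (y, t) \<bullet> v"
      unfolding grad_def inner_sum_left
      by (intro sum.cong refl) (simp add: inner_commute)
    finally show ?thesis .
  qed
  have cgrad: "continuous_on (U \<times> K) grad"
    unfolding grad_def by (intro continuous_intros cD)
  note int = set_integrable_continuous_compact[OF KV(1)]
  have "linear (\<lambda>v. LINT t:K|lborel. ?D v (x, t))"
  proof (rule linearI)
    show "(LINT t:K|lborel. ?D (u + v) (x, t)) = (LINT t:K|lborel. ?D u (x, t)) + (LINT t:K|lborel. ?D v (x, t))" for u v
    proof -
      have "(LINT t:K|lborel. ?D (u + v) (x, t)) = (LINT t:K|lborel. ?D u (x, t) + ?D v (x, t))"
        using KV(1) linear_add[OF lin[OF x]] by (intro set_lebesgue_integral_cong) (auto simp: compact_imp_closed)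
      then show ?thesis using set_integral_add(2)[OF int[OF slice[OF x cD]] int[OF slice[OF x cD]]] by simp
    qed
    show "(LINT t:K|lborel. ?D (c *\<^sub>R v) (x, t)) = c *\<^sub>R (LINT t:K|lborel. ?D v (x, t))" for c v
    proof -
      have "(LINT t:K|lborel. ?D (c *\<^sub>R v) (x, t)) = (LINT t:K|lborel. c * ?D v (x, t))"
        using KV(1) linear_cmul[OF lin[OF x]] by (intro set_lebesgue_integral_cong) (auto simp: compact_imp_closed)
      then show ?thesis by simp
    qed
  qed
  then have bl: "bounded_linear (\<lambda>v. LINT t:K|lborel. ?D v (x, t))" by (simp add: linear_linear)
  show ?thesis
    unfolding has_derivative_at_alt
  proof (intro conjI bl allI impI)
    fix e :: real assume e: "0 < e"
    define m where "m = measure lborel K"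
    have m: "0 \<le> m" by (simp add: m_def)
    define e' where "e' = e / (m + 1)"
    have e': "0 < e'" using e m by (simp add: e'_def)
    obtain X where X: "x \<in> X" "open X" "\<forall>y\<in>X \<inter> U. \<forall>t\<in>K. dist (grad (y, t)) (grad (x, t)) \<le> e'"
      by (rule continuous_on_prod_compactE[OF cgrad KV(1) x e'])
    obtain d where d: "0 < d" "ball x d \<subseteq> X \<inter> U"
      using openE[of "X \<inter> U" x] U X(1,2) x by blast
    have bound: "\<bar>f (y, t) - f (x, t) - ?D (y - x) (x, t)\<bar> \<le> e' * norm (y - x)"
      if y: "norm (y - x) < d" and t: "t \<in> K" for y t
    proof -
      let ?\<gamma> = "\<lambda>s. (x, t) + s *\<^sub>R (y - x, 0)"
      have seg: "x + s *\<^sub>R (y - x) \<in> X \<inter> U" if "0 \<le> s" "s \<le> 1" for s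
      proof -
        have "norm (s *\<^sub>R (y - x)) \<le> norm (y - x)" using that by (simp add: mult_left_le_one_le)
        then show ?thesis using y d(2) by (auto simp: dist_norm norm_minus_commute subset_iff)
      qed
      have "((\<lambda>s. f (?\<gamma> s)) has_real_derivative frechet_derivative f (at (?\<gamma> s)) (y - x, 0)) (at s)"
        if "0 \<le> s" "s \<le> 1" for s
        using seg[OF that] t KV(2) by (intro smooth_on_line_derivative[OF f]) auto
      from MVT2[OF zero_less_one this] obtain s where s: "0 < s" "s < 1"
        "f (?\<gamma> 1) - f (?\<gamma> 0) = (1 - 0) * frechet_derivative f (at (?\<gamma> s)) (y - x, 0)" by blast
      have sX: "x + s *\<^sub>R (y - x) \<in> X \<inter> U" using seg s by simp
      have "f (y, t) - f (x, t) = ?D (y - x) (x + s *\<^sub>R (y - x), t)"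
        using s(3) by simp
      then have "f (y, t) - f (x, t) - ?D (y - x) (x, t) = (grad (x + s *\<^sub>R (y - x), t) - grad (x, t)) \<bullet> (y - x)"
        using sX x t by (simp add: grad inner_diff_left)
      also have "\<bar>\<dots>\<bar> \<le> norm (grad (x + s *\<^sub>R (y - x), t) - grad (x, t)) * norm (y - x)"
        by (rule Cauchy_Schwarz_ineq2)
      also have "\<dots> \<le> e' * norm (y - x)"
        using X(3)[rule_format, OF sX t] by (intro mult_right_mono) (auto simp: dist_norm)
      finally show ?thesis .
    qed
    show "\<exists>d>0. \<forall>y. norm (y - x) < d \<longrightarrow> norm ((LINT t:K|lborel. f (y, t)) - (LINT t:K|lborel. f (x, t)) -
        (LINT t:K|lborel. ?D (y - x) (x, t))) \<le> e * norm (y - x)"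
    proof (intro exI conjI allI impI)
      fix y assume y: "norm (y - x) < d"
      then have yU: "y \<in> U" using d by (auto simp: dist_norm norm_minus_commute subset_iff)
      note cy = slice[OF yU cf] and cx = slice[OF x cf] and cd = slice[OF x cD, of "y - x"]
      have "(LINT t:K|lborel. f (y, t)) - (LINT t:K|lborel. f (x, t)) - (LINT t:K|lborel. ?D (y - x) (x, t)) =
          (LINT t:K|lborel. f (y, t) - f (x, t) - ?D (y - x) (x, t))"
        using set_integral_diff[OF int[OF cy] int[OF cx]]
          set_integral_diff(2)[OF set_integral_diff(1)[OF int[OF cy] int[OF cx]] int[OF cd]] by simp
      also have "\<bar>\<dots>\<bar> \<le> (e' * norm (y - x)) * m"
        unfolding m_def using bound[OF y]
        by (intro set_integral_le_measure[OF KV(1)] continuous_on_diff cy cx cd)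
      also have "\<dots> \<le> e * norm (y - x)"
      proof -
        have "e' * m \<le> e' * (m + 1)" using e' by simp
        also have "\<dots> = e" using m by (simp add: e'_def)
        finally show ?thesis using mult_right_mono[of "e' * m" e "norm (y - x)"] by (simp add: mult_ac)
      qed
      finally show "norm ((LINT t:K|lborel. f (y, t)) - (LINT t:K|lborel. f (x, t)) -
        (LINT t:K|lborel. ?D (y - x) (x, t))) \<le> e * norm (y - x)" by simp
    qed (rule d)
  qed
qed

text \<open>The derivative of a parametric integral is again a parametric integral of a smooth function, so the
induction on the order of differentiability closes.\<close>

lemma smooth_on_parametric_integral:
  fixes f :: "'a::euclidean_space \<times> 'b::euclidean_space \<Rightarrow> real"
  assumes U: "open U" and KV: "compact K" "K \<subseteq> V" and f: "smooth_on (U \<times> V) f"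
  shows "smooth_on U (\<lambda>x. LINT t:K|lborel. f (x, t))"
proof -
  have "Ck_on k U (\<lambda>x. LINT t:K|lborel. f (x, t))" for k
    using f
  proof (induction k arbitrary: f)
    case 0
    then have "continuous_on (U \<times> K) f"
      using smooth_on_imp_continuous_on KV(2) by (meson Sigma_mono continuous_on_subset order_refl)
    then show ?case using continuous_on_parametric_integral[OF KV(1)] by simp
  next
    case (Suc k)
    show ?case
      by (rule Ck_on_Suc_derivI[OF U has_derivative_parametric_integral[OF U KV Suc.prems]
            Suc.IH[OF smooth_on_frechet_derivative[OF Suc.prems]]])
  qed
  then show ?thesis by (simp add: smooth_on_def)
qed

section \<open>Minkowski norms\<close>

text \<open>If \<open>F\<close> is homogeneous, its derivative is homogeneous of one degree less: differentiate
\<open>F (t *\<^sub>R z) = c * F z\<close> in \<open>z\<close>. Applied twice to \<open>f\<^sup>2\<close>, this makes the fundamental tensor homogeneous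
of degree 0.\<close>

lemma frechet_derivative_scaling:
  fixes F :: "'a::real_normed_vector \<Rightarrow> real"
  assumes F: "smooth_on (- {0}) F" and hom: "\<And>z. z \<noteq> 0 \<Longrightarrow> F (t *\<^sub>R z) = c * F z" and t: "t \<noteq> 0" and y: "y \<noteq> 0"
  shows "t * frechet_derivative F (at (t *\<^sub>R y)) u = c * frechet_derivative F (at y) u"
proof -
  note d1 = smooth_on_has_derivative[OF F, of "t *\<^sub>R y"]
  note d2 = smooth_on_has_derivative[OF F, of y]
  have "((\<lambda>z. t *\<^sub>R z) has_derivative (\<lambda>v. t *\<^sub>R v)) (at y)"
    by (auto intro!: derivative_eq_intros)
  from has_derivative_compose[OF this] d1 t y
  have "((\<lambda>z. F (t *\<^sub>R z)) has_derivative (\<lambda>v. frechet_derivative F (at (t *\<^sub>R y)) (t *\<^sub>R v))) (at y)"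
    by simp
  then have "((\<lambda>z. c * F z) has_derivative (\<lambda>v. frechet_derivative F (at (t *\<^sub>R y)) (t *\<^sub>R v))) (at y)"
    by (rule has_derivative_transform_within_open[where s="- {0}"]) (use y hom in auto)
  moreover have "((\<lambda>z. c * F z) has_derivative (\<lambda>v. c * frechet_derivative F (at y) v)) (at y)"
    using d2 y by (intro has_derivative_mult_right) auto
  ultimately have "(\<lambda>v. frechet_derivative F (at (t *\<^sub>R y)) (t *\<^sub>R v)) = (\<lambda>v. c * frechet_derivative F (at y) v)"
    by (rule has_derivative_unique)
  then have "frechet_derivative F (at (t *\<^sub>R y)) (t *\<^sub>R u) = c * frechet_derivative F (at y) u"
    by meson
  moreover have "frechet_derivative F (at (t *\<^sub>R y)) (t *\<^sub>R u) = t * frechet_derivative F (at (t *\<^sub>R y)) u"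
    using linear_cmul[OF has_derivative_linear[OF d1]] t y by simp
  ultimately show ?thesis by simp
qed

lemma euler_homogeneous:
  fixes F :: "'a::real_normed_vector \<Rightarrow> real"
  assumes F: "smooth_on (- {0}) F" and hom: "\<And>s. 0 < s \<Longrightarrow> F (s *\<^sub>R y) = s ^ k * F y" and y: "y \<noteq> 0"
  shows "frechet_derivative F (at y) y = real k * F y"
proof -
  have "((\<lambda>s. F (0 + s *\<^sub>R y)) has_real_derivative frechet_derivative F (at (0 + 1 *\<^sub>R y)) y) (at 1)"
    by (rule smooth_on_line_derivative[OF F]) (use y in simp)
  then have "((\<lambda>s. F (s *\<^sub>R y)) has_real_derivative frechet_derivative F (at y) y) (at 1)" by simp
  then have "((\<lambda>s. s ^ k * F y) has_real_derivative frechet_derivative F (at y) y) (at 1)"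
    by (rule has_field_derivative_transform_within_open[where S="{0<..}"]) (auto simp: hom)
  moreover have "((\<lambda>s. s ^ k * F y) has_real_derivative real k * F y) (at 1)"
    by (auto intro!: derivative_eq_intros)
  ultimately show ?thesis by (rule DERIV_unique)
qed

text \<open>The segment from the identity to \<open>M\<close> consists of matrices that are definite in this sense, hence
invertible, so the determinant keeps its sign along it.\<close>

lemma det_pos_of_positive_definite:
  fixes M :: "real^'n::finite^'n"
  assumes pd: "\<And>w. w \<noteq> 0 \<Longrightarrow> 0 < w \<bullet> (M *v w)"
  shows "0 < det M"
proof (rule ccontr)
  assume "\<not> 0 < det M"
  define c where "c t = det (t *\<^sub>R M + (1 - t) *\<^sub>R mat 1)" for t :: real
  have nz: "c t \<noteq> 0" if t: "0 \<le> t" "t \<le> 1" for t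
  proof
    assume "c t = 0"
    let ?N = "t *\<^sub>R M + (1 - t) *\<^sub>R mat 1"
    from \<open>c t = 0\<close> have "\<not> invertible ?N" by (simp add: c_def invertible_det_nz)
    then obtain w where w: "?N *v w = 0" "w \<noteq> 0"
      using matrix_left_invertible_ker invertible_left_inverse by blast
    have "w \<bullet> (?N *v w) = t * (w \<bullet> (M *v w)) + (1 - t) * (w \<bullet> w)"
      by (simp add: matrix_vector_mult_add_rdistrib scaleR_matrix_vector_assoc[symmetric] inner_add_right)
    moreover have "0 < t * (w \<bullet> (M *v w)) + (1 - t) * (w \<bullet> w)"
    proof (cases "t = 0")
      case False
      then show ?thesis using t pd[OF w(2)] by (intro add_pos_nonneg mult_pos_pos) auto
    qed (use w in auto)
    ultimately show False using w by simp
  qed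
  have "continuous_on {0..1} c"
    unfolding c_def det_def by (intro continuous_intros)
  moreover have "c 0 = 1" "c 1 = det M" by (simp_all add: c_def)
  ultimately obtain t where "0 \<le> t" "t \<le> 1" "c t = 0"
    using IVT2'[of c 1 0 0] \<open>\<not> 0 < det M\<close> by auto
  with nz show False by blast
qed

text \<open>The restriction of a Finsler function to one tangent space.\<close>

locale minkowski_norm =
  fixes f :: "real^'n::finite \<Rightarrow> real"
  assumes smooth: "smooth_on (- {0}) f"
    and homogeneous: "0 \<le> t \<Longrightarrow> f (t *\<^sub>R y) = t * f y"
    and nonneg: "0 \<le> f y"
    and posdef: "y \<noteq> 0 \<Longrightarrow> w \<noteq> 0 \<Longrightarrow> 0 < w \<bullet> (fundamental_tensor f y *v w)"
begin

lemma zero: "f 0 = 0"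
  using homogeneous[of 0 0] by simp

lemma smooth_square: "smooth_on (- {0}) (\<lambda>z. (f z)\<^sup>2)"
  by (intro smooth_on_power smooth) (simp add: open_Compl)

end

text \<open>The coordinate-free form of the fundamental tensor, in which its behaviour under linear maps and
scalings can be read off from the chain rule.\<close>

lemma fundamental_tensor_second_derivative:
  fixes f :: "real^'n::finite \<Rightarrow> real"
  assumes f: "smooth_on (- {0}) (\<lambda>z. (f z)\<^sup>2)" and y: "y \<noteq> 0"
  shows "u \<bullet> (fundamental_tensor f y *v v) =
    (1/2) * frechet_derivative (\<lambda>z. frechet_derivative (\<lambda>z. (f z)\<^sup>2) (at z) v) (at y) u"
proof -
  let ?D = "\<lambda>v z. frechet_derivative (\<lambda>z. (f z)\<^sup>2) (at z) v"
  have sD: "smooth_on (- {0}) (?D v)" for v by (rule smooth_on_frechet_derivative[OF f])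
  have dD: "(?D v has_derivative frechet_derivative (?D v) (at y)) (at y)" for v
    using smooth_on_has_derivative[OF sD] y by simp
  have expand: "?D v z = (\<Sum>j\<in>UNIV. v $ j * ?D (axis j 1) z)" if "z \<noteq> 0" for z
  proof -
    have lin: "linear (\<lambda>v. ?D v z)"
      using has_derivative_linear[OF smooth_on_has_derivative[OF f]] that by simp
    have "?D v z = ?D (\<Sum>j\<in>UNIV. v $ j *\<^sub>R axis j 1) z"
      by (simp add: basis_expansion flip: scalar_mult_eq_scaleR)
    also have "\<dots> = (\<Sum>j\<in>UNIV. v $ j * ?D (axis j 1) z)"
      by (subst linear_sum[OF lin]) (simp add: linear_cmul[OF lin])
    finally show ?thesis .
  qed
  have "((\<lambda>z. \<Sum>j\<in>UNIV. v $ j * ?D (axis j 1) z) has_derivative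
      (\<lambda>u. \<Sum>j\<in>UNIV. v $ j * frechet_derivative (?D (axis j 1)) (at y) u)) (at y)"
    by (intro has_derivative_sum has_derivative_mult_right dD)
  then have "(?D v has_derivative (\<lambda>u. \<Sum>j\<in>UNIV. v $ j * frechet_derivative (?D (axis j 1)) (at y) u)) (at y)"
    by (rule has_derivative_transform_within_open[where s="- {0}"]) (use y expand in auto)
  then have outer: "frechet_derivative (?D v) (at y) = (\<lambda>u. \<Sum>j\<in>UNIV. v $ j * frechet_derivative (?D (axis j 1)) (at y) u)"
    by (rule frechet_derivative_at[symmetric])
  have inner: "frechet_derivative (?D w) (at y) u = (\<Sum>i\<in>UNIV. u $ i * frechet_derivative (?D w) (at y) (axis i 1))" for w
  proof -
    note lin = has_derivative_linear[OF dD[of w]]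
    have "frechet_derivative (?D w) (at y) u = frechet_derivative (?D w) (at y) (\<Sum>i\<in>UNIV. u $ i *\<^sub>R axis i 1)"
      by (simp add: basis_expansion flip: scalar_mult_eq_scaleR)
    also have "\<dots> = (\<Sum>i\<in>UNIV. u $ i * frechet_derivative (?D w) (at y) (axis i 1))"
      by (subst linear_sum[OF lin]) (simp add: linear_cmul[OF lin])
    finally show ?thesis .
  qed
  have "u \<bullet> (fundamental_tensor f y *v v) =
      (\<Sum>i\<in>UNIV. \<Sum>j\<in>UNIV. u $ i * (1/2 * frechet_derivative (?D (axis j 1)) (at y) (axis i 1) * v $ j))"
    by (simp add: inner_vec_def matrix_vector_mult_def fundamental_tensor_def partial_deriv_def[abs_def] sum_distrib_left)
  also have "\<dots> = (\<Sum>j\<in>UNIV. \<Sum>i\<in>UNIV. u $ i * (1/2 * frechet_derivative (?D (axis j 1)) (at y) (axis i 1) * v $ j))"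
    by (rule sum.swap)
  also have "\<dots> = (1/2) * frechet_derivative (?D v) (at y) u"
    unfolding outer by (subst inner) (simp add: sum_distrib_left mult_ac)
  finally show ?thesis .
qed

lemma inner_axis_matrix_axis:
  fixes M :: "real^'n::finite^'n"
  shows "axis i 1 \<bullet> (M *v axis j 1) = M $ i $ j"
  by (simp add: inner_axis' matrix_vector_mult_basis column_def)

context minkowski_norm
begin

lemma fundamental_tensor_sym:
  assumes "y \<noteq> 0" shows "fundamental_tensor f y $ i $ j = fundamental_tensor f y $ j $ i"
  using smooth_on_derivatives_commute[OF _ smooth_square, of y "axis j 1" "axis i 1"] assms
  by (simp add: fundamental_tensor_def partial_deriv_def[abs_def] open_Compl)

lemma derivative_square_homogeneous:
  assumes "0 < t" "z \<noteq> 0"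
  shows "frechet_derivative (\<lambda>z. (f z)\<^sup>2) (at (t *\<^sub>R z)) v = t * frechet_derivative (\<lambda>z. (f z)\<^sup>2) (at z) v"
  using frechet_derivative_scaling[OF smooth_square, of t "t\<^sup>2" z v] assms
  by (simp add: homogeneous power_mult_distrib power2_eq_square)

lemma fundamental_tensor_homogeneous:
  assumes "0 < t" "y \<noteq> 0"
  shows "fundamental_tensor f (t *\<^sub>R y) = fundamental_tensor f y"
  using frechet_derivative_scaling[OF smooth_on_frechet_derivative[OF smooth_square], of t _ t y]
    derivative_square_homogeneous assms
  by (simp add: vec_eq_iff fundamental_tensor_def partial_deriv_def[abs_def])

text \<open>Euler's theorem for homogeneous functions, once for \<open>f\<^sup>2\<close> (of degree 2) and once for its derivative in a
fixed direction (of degree 1). Together with definiteness this forces \<open>f\<close> to be positive off the origin.\<close>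

lemma fundamental_tensor_self:
  assumes "y \<noteq> 0" shows "y \<bullet> (fundamental_tensor f y *v y) = (f y)\<^sup>2"
proof -
  let ?D = "\<lambda>v z. frechet_derivative (\<lambda>z. (f z)\<^sup>2) (at z) v"
  have "frechet_derivative (?D y) (at y) y = ?D y y"
    using euler_homogeneous[OF smooth_on_frechet_derivative[OF smooth_square], of y y 1]
      derivative_square_homogeneous assms by simp
  moreover have "?D y y = 2 * (f y)\<^sup>2"
    using euler_homogeneous[OF smooth_square, of y 2] assms
    by (simp add: homogeneous power_mult_distrib)
  ultimately show ?thesis
    using fundamental_tensor_second_derivative[OF smooth_square assms, of y y] by simp
qed

lemma pos: "y \<noteq> 0 \<Longrightarrow> 0 < f y"
  using fundamental_tensor_self[of y] posdef[of y y] nonneg[of y] by (auto simp: less_le)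

lemma eq_0_iff: "f y = 0 \<longleftrightarrow> y = 0"
  using pos[of y] zero by (metis less_irrefl)

lemma continuous_on: "continuous_on (- {0}) f"
  by (rule smooth_on_imp_continuous_on[OF smooth])

lemma smooth_fundamental_tensor: "smooth_on (- {0}) (\<lambda>y. fundamental_tensor f y $ i $ j)"
proof -
  have "smooth_on (- {0}) (\<lambda>y. (1/2) *
      frechet_derivative (\<lambda>y. frechet_derivative (\<lambda>z. (f z)\<^sup>2) (at y) (axis j 1)) (at y) (axis i 1))"
    by (intro smooth_on_mult smooth_on_const smooth_on_frechet_derivative smooth_square) (simp add: open_Compl)
  then show ?thesis by (simp add: fundamental_tensor_def partial_deriv_def[abs_def])
qed

lemma det_pos: "y \<noteq> 0 \<Longrightarrow> 0 < det (fundamental_tensor f y)"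
  by (rule det_pos_of_positive_definite[OF posdef])

lemma continuous_on_sqrt_det: "continuous_on (- {0}) (\<lambda>y. sqrt (det (fundamental_tensor f y)))"
  by (intro smooth_on_imp_continuous_on smooth_on_sqrt smooth_on_det smooth_fundamental_tensor det_pos)
    (auto simp: open_Compl)

end

text \<open>The chain rule, applied twice to \<open>f\<^sup>2 = f'\<^sup>2 \<circ> L\<close>, says that the fundamental tensor pulls back along
\<open>L\<close> as a bilinear form, that is, \<open>g = L\<^sup>T g' L\<close> in terms of matrices.\<close>

lemma fundamental_tensor_linear:
  fixes f f' :: "real^'n::finite \<Rightarrow> real"
  assumes f': "smooth_on (- {0}) (\<lambda>z. (f' z)\<^sup>2)" and L: "linear L" "inj L"
    and f: "\<And>y. f y = f' (L y)" and y: "y \<noteq> 0"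
  shows "u \<bullet> (fundamental_tensor f y *v v) = L u \<bullet> (fundamental_tensor f' (L y) *v L v)"
    and "det (fundamental_tensor f y) = (det (matrix L))\<^sup>2 * det (fundamental_tensor f' (L y))"
proof -
  have bl: "bounded_linear L" using L by (simp add: linear_linear)
  have Lnz: "L z \<noteq> 0" if "z \<noteq> 0" for z
    using L that by (metis injD linear_0)
  have dL: "(L has_derivative L) (at z)" for z by (rule bounded_linear_imp_has_derivative[OF bl])
  have chain: "frechet_derivative (\<lambda>z. F (L z)) (at z) v = frechet_derivative F (at (L z)) (L v)"
    if "smooth_on (- {0}) F" "z \<noteq> 0" for F :: "real^'n \<Rightarrow> real" and z v
  proof -
    have "(F has_derivative frechet_derivative F (at (L z))) (at (L z))"
      using smooth_on_has_derivative[OF that(1)] Lnz[OF that(2)] by simp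
    from frechet_derivative_at[OF has_derivative_compose[OF dL this]] show ?thesis by metis
  qed
  have s: "smooth_on (- {0}) (\<lambda>z. (f z)\<^sup>2)"
    using smooth_on_compose_affine[OF _ f' bl, of "- {0}" 0] Lnz by (simp add: f open_Compl)
  have quad: "u \<bullet> (fundamental_tensor f y *v v) = L u \<bullet> (fundamental_tensor f' (L y) *v L v)" for u v
  proof -
    let ?D' = "\<lambda>z. frechet_derivative (\<lambda>z. (f' z)\<^sup>2) (at z) (L v)"
    have "frechet_derivative (\<lambda>z. frechet_derivative (\<lambda>z. (f z)\<^sup>2) (at z) v) (at y) =
        frechet_derivative (\<lambda>z. ?D' (L z)) (at y)"
    proof (rule frechet_derivative_transform_within_open[where X="- {0}"])
      show "frechet_derivative (\<lambda>z. (f z)\<^sup>2) (at z) v = ?D' (L z)" if "z \<in> - {0}" for z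
        using chain[OF f', of z v] that by (simp add: f)
      show "(\<lambda>z. frechet_derivative (\<lambda>z. (f z)\<^sup>2) (at z) v) differentiable at y"
        using smooth_on_has_derivative[OF smooth_on_frechet_derivative[OF s]] y
        by (auto simp: differentiable_def)
    qed (use y in auto)
    then show ?thesis
      using chain[OF smooth_on_frechet_derivative[OF f'] y]
      by (simp add: fundamental_tensor_second_derivative[OF s y] fundamental_tensor_second_derivative[OF f' Lnz[OF y]])
  qed
  then show "u \<bullet> (fundamental_tensor f y *v v) = L u \<bullet> (fundamental_tensor f' (L y) *v L v)" .
  have "fundamental_tensor f y = transpose (matrix L) ** fundamental_tensor f' (L y) ** matrix L"
  proof -
    have "fundamental_tensor f y $ i $ j =
        (transpose (matrix L) ** fundamental_tensor f' (L y) ** matrix L) $ i $ j" for i j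
    proof -
      have "fundamental_tensor f y $ i $ j =
          (matrix L *v axis i 1) \<bullet> (fundamental_tensor f' (L y) *v (matrix L *v axis j 1))"
        using quad[of "axis i 1" "axis j 1"] L by (simp add: inner_axis_matrix_axis matrix_works)
      also have "\<dots> = (fundamental_tensor f' (L y) *v (matrix L *v axis j 1)) \<bullet> (matrix L *v axis i 1)"
        by (rule inner_commute)
      also have "\<dots> = ((fundamental_tensor f' (L y) *v (matrix L *v axis j 1)) v* matrix L) \<bullet> axis i 1"
        by (rule dot_lmul_matrix[symmetric])
      also have "\<dots> = axis i 1 \<bullet> (transpose (matrix L) *v (fundamental_tensor f' (L y) *v (matrix L *v axis j 1)))"
        by (simp only: transpose_matrix_vector inner_commute)
      also have "\<dots> = axis i 1 \<bullet> ((transpose (matrix L) ** fundamental_tensor f' (L y) ** matrix L) *v axis j 1)"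
        by (simp only: matrix_vector_mul_assoc[symmetric])
      finally show ?thesis by (simp add: inner_axis_matrix_axis)
    qed
    then show ?thesis by (simp add: vec_eq_iff)
  qed
  then show "det (fundamental_tensor f y) = (det (matrix L))\<^sup>2 * det (fundamental_tensor f' (L y))"
    by (simp add: det_mul det_transpose power2_eq_square)
qed

section \<open>The cone measure of the indicatrix\<close>

lemma AE_hyperplane_lborel: "AE u in hyperplane_lborel k. u \<in> hyperplane (k::'n::finite)"
proof -
  note measurable_hyperplane_embedding[of k]
  moreover have "hyperplane k \<in> sets borel"
    unfolding hyperplane_def by measurable
  ultimately show ?thesis
    unfolding hyperplane_lborel_def
    by (subst AE_distr_iff) (simp_all add: hyperplane_def)
qed

text \<open>For a 1-homogeneous \<open>q\<close> the shell meets every ray in a segment whose end points have ratio 2.\<close>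

definition shell :: "(real^'n \<Rightarrow> real) \<Rightarrow> (real^'n) set" where
  "shell q = {y. 1 \<le> q y \<and> q y \<le> 2}"

text \<open>The functions \<open>q\<close> that may be used to cut out a bounded piece of every ray.\<close>

locale gauge =
  fixes q :: "real^'n::finite \<Rightarrow> real"
  assumes continuous: "continuous_on UNIV q"
    and homogeneous: "0 \<le> t \<Longrightarrow> q (t *\<^sub>R y) = t * q y"
    and positive: "y \<noteq> 0 \<Longrightarrow> 0 < q y"
begin

lemma measurable[measurable]: "q \<in> borel_measurable borel"
  by (rule borel_measurable_continuous_onI[OF continuous])

lemma zero_notin_shell: "0 \<notin> shell q"
  using homogeneous[of 0 0] by (simp add: shell_def)

lemma shell_measurable[measurable]: "shell q \<in> sets borel"
  unfolding shell_def by measurable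

text \<open>In the logarithmic coordinate \<open>r\<close> along a ray, the shell has length \<open>ln 2\<close>, whatever the gauge and the
ray. This is why the cone measure does not depend on the gauge.\<close>

lemma log_length:
  fixes a c :: real
  assumes "0 < c"
  shows "(\<integral>\<^sup>+r. indicator {r. 1 \<le> exp (a + r) * c \<and> exp (a + r) * c \<le> 2} r \<partial>lborel) = ennreal (ln 2)"
proof -
  have "1 \<le> exp (a + r) * c \<and> exp (a + r) * c \<le> 2 \<longleftrightarrow> r \<in> {- ln c - a..ln 2 - ln c - a}" for r
  proof -
    have "exp (a + r) * c = exp (a + r + ln c)" using assms by (simp add: exp_add)
    moreover have "1 \<le> exp (a + r + ln c) \<longleftrightarrow> 0 \<le> a + r + ln c" by simp
    moreover have "exp (a + r + ln c) \<le> 2 \<longleftrightarrow> a + r + ln c \<le> ln 2"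
      by (metis exp_le_cancel_iff exp_ln zero_less_numeral)
    ultimately show ?thesis by auto
  qed
  then have "{r. 1 \<le> exp (a + r) * c \<and> exp (a + r) * c \<le> 2} = {- ln c - a..ln 2 - ln c - a}"
    by blast
  then show ?thesis by simp
qed

end

text \<open>The exponent makes the density homogeneous of degree \<open>-n\<close>, so that \<open>cone_density f y dy\<close> is invariant
under dilations.\<close>

definition cone_density :: "(real^'n::finite \<Rightarrow> real) \<Rightarrow> real^'n \<Rightarrow> real" where
  "cone_density f y = sqrt (det (fundamental_tensor f y)) / f y ^ CARD('n)"

text \<open>The image of the dilation invariant measure \<open>cone_density f y dy\<close> on a shell under radial projection to
the indicatrix. The factor \<open>1 / ln 2\<close> compensates the logarithmic thickness of the shell.\<close>

definition cone_measure :: "(real^'n::finite \<Rightarrow> real) \<Rightarrow> (real^'n \<Rightarrow> real) \<Rightarrow> (real^'n) measure" where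
  "cone_measure q f =
     distr (density (restrict_space lborel (shell q)) (\<lambda>y. ennreal (cone_density f y / ln 2)))
       (restrict_space borel (indicatrix f)) (\<lambda>y. y /\<^sub>R f y)"

context minkowski_norm
begin

lemma cone_density_nonneg: "0 \<le> cone_density f y"
  using nonneg[of y] det_pos[of y] zero
  by (cases "y = 0") (auto simp: cone_density_def power_0_left)

lemma measurable_off_zero:
  fixes h :: "real^'n \<Rightarrow> 'b::real_normed_vector"
  assumes "continuous_on (- {0}) h" "h 0 = 0"
  shows "h \<in> borel_measurable borel"
proof -
  have "(\<lambda>x. indicator (- {0}) x *\<^sub>R h x) \<in> borel_measurable borel"
    by (rule borel_measurable_continuous_on_indicator[OF _ assms(1)]) (simp add: open_Compl borel_open)
  moreover have "(\<lambda>x. indicator (- {0}) x *\<^sub>R h x) = h"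
    using assms(2) by (auto simp: indicator_def)
  ultimately show ?thesis by simp
qed

lemma continuous_on_cone_density: "continuous_on (- {0}) (cone_density f)"
  unfolding cone_density_def using pos
  by (intro continuous_intros continuous_on_sqrt_det continuous_on) (auto simp: less_le)

lemma measurable_cone_density[measurable]: "cone_density f \<in> borel_measurable borel"
  by (rule measurable_off_zero[OF continuous_on_cone_density]) (simp add: cone_density_def zero)

lemma measurable_normalize[measurable]: "(\<lambda>y. y /\<^sub>R f y) \<in> borel_measurable borel"
  by (rule measurable_off_zero) (use pos in \<open>auto intro!: continuous_intros continuous_on simp: less_le\<close>)

lemma normalize_in_indicatrix: "y \<noteq> 0 \<Longrightarrow> y /\<^sub>R f y \<in> indicatrix f"
  using pos[of y] homogeneous[of "inverse (f y)" y] by (simp add: indicatrix_def)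

lemma normalize_measurable_indicatrix:
  assumes "gauge q"
  shows "(\<lambda>y. y /\<^sub>R f y) \<in> restrict_space borel (shell q) \<rightarrow>\<^sub>M restrict_space borel (indicatrix f)"
proof (rule measurable_restrict_space3[OF measurable_normalize])
  show "(\<lambda>y. y /\<^sub>R f y) \<in> shell q \<rightarrow> indicatrix f"
    using gauge.zero_notin_shell[OF assms] normalize_in_indicatrix by (auto simp: Pi_def) metis
qed

lemma indicatrix_measurable: "indicatrix f \<in> sets borel"
proof -
  have "f \<in> borel_measurable borel" by (rule measurable_off_zero[OF continuous_on zero])
  then have "f -` {1} \<inter> space borel \<in> sets borel" by (rule measurable_sets) simp
  then show ?thesis by (simp add: indicatrix_def vimage_def)
qed

lemma emeasure_cone_measure:
  assumes q: "gauge q" and B: "B \<in> sets borel" "B \<subseteq> indicatrix f"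
  shows "emeasure (cone_measure q f) B =
    (\<integral>\<^sup>+y\<in>{y \<in> shell q. y /\<^sub>R f y \<in> B}. ennreal (cone_density f y / ln 2) \<partial>lborel)"
proof -
  interpret gauge q by (rule q)
  let ?M = "density (restrict_space lborel (shell q)) (\<lambda>y. ennreal (cone_density f y / ln 2))"
  have sM: "sets ?M = sets (restrict_space borel (shell q))" by (simp add: sets_restrict_space)
  have BI: "B \<in> sets (restrict_space borel (indicatrix f))"
    using B indicatrix_measurable by (simp add: sets_restrict_space_iff)
  have m: "(\<lambda>y. y /\<^sub>R f y) \<in> ?M \<rightarrow>\<^sub>M restrict_space borel (indicatrix f)"
    using normalize_measurable_indicatrix[OF q] measurable_cong_sets[OF sM refl] by blast
  let ?A = "{y \<in> shell q. y /\<^sub>R f y \<in> B}"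
  have eq: "(\<lambda>y. y /\<^sub>R f y) -` B \<inter> space ?M = ?A" by (auto simp: space_restrict_space)
  have A: "?A \<in> sets ?M" using measurable_sets[OF m BI] eq by simp
  have "emeasure (cone_measure q f) B = emeasure ?M ?A"
    unfolding cone_measure_def using emeasure_distr[OF m BI] eq by simp
  also have "\<dots> = (\<integral>\<^sup>+y\<in>?A. ennreal (cone_density f y / ln 2) \<partial>restrict_space lborel (shell q))"
    using A by (intro emeasure_density) (auto intro!: measurable_restrict_space1 simp: sets_restrict_space)
  also have "\<dots> = (\<integral>\<^sup>+y\<in>?A. ennreal (cone_density f y / ln 2) \<partial>lborel)"
    by (subst nn_integral_restrict_space) (auto intro!: nn_integral_cong simp: indicator_def)
  finally show ?thesis .
qed

text \<open>Existence of the measure on the indicatrix. A parametrization \<open>\<psi>\<close> defined on a piece of the hyperplane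
\<open>z\<^sub>k = 0\<close> extends to the parametrization \<open>\<Theta> z = exp z\<^sub>k *\<^sub>R \<psi> u\<close> of the cone over its image, where \<open>u\<close> is the
projection of \<open>z\<close> to the hyperplane. The Jacobian of \<open>\<Theta>\<close> is \<open>exp z\<^sub>k ^ n\<close> times the determinant in the
volume form, and the homogeneity of the density cancels the first factor. So the transformed
integrand depends on \<open>u\<close> only, and integrating out \<open>z\<^sub>k\<close> contributes the factor \<open>ln 2\<close>.\<close>

lemma cone_measure_local_parametrization:
  assumes q: "gauge q" and \<psi>: "local_parametrization (indicatrix f) k W \<psi>"
    and B: "B \<in> sets borel" "B \<subseteq> \<psi> ` (W \<inter> hyperplane k)"
  shows "emeasure (cone_measure q f) B =
    (\<integral>\<^sup>+u\<in>{u \<in> W \<inter> hyperplane k. \<psi> u \<in> B}.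
       ennreal \<bar>indicatrix_form f (\<psi> u) k (\<lambda>j. partial_deriv j \<psi> u)\<bar> \<partial>hyperplane_lborel k)"
proof -
  interpret q: gauge q by (rule q)
  define n where "n = CARD('n)"
  have W: "open W" and sm: "smooth_on W \<psi>" and inj: "inj_on \<psi> (W \<inter> hyperplane k)"
    using \<psi> unfolding local_parametrization_def by auto
  have im: "\<psi> u \<in> indicatrix f" if "u \<in> W \<inter> hyperplane k" for u
    using \<psi> that unfolding local_parametrization_def by auto
  have f1: "f (\<psi> u) = 1" and nz: "\<psi> u \<noteq> 0" if "u \<in> W \<inter> hyperplane k" for u
    using im[OF that] zero by (auto simp: indicatrix_def)
  have BI: "B \<subseteq> indicatrix f" using B(2) im by blast
  define pr where "pr z = z - (z $ k) *\<^sub>R axis k 1" for z :: "real^'n"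
  have pr_H: "pr z \<in> hyperplane k" for z by (simp add: pr_def hyperplane_def)
  have pr_id: "pr u = u" if "u \<in> hyperplane k" for u using that by (simp add: pr_def hyperplane_def)
  have pr_shift: "pr (u + r *\<^sub>R axis k 1) = pr u" for u r
    by (simp add: pr_def algebra_simps)
  have pr_lin: "bounded_linear pr"
    unfolding pr_def by (intro bounded_linear_intros bounded_linear_vec_nth) 
  have [measurable]: "pr \<in> borel_measurable borel"
    using pr_lin by (simp add: linear_continuous_on borel_measurable_continuous_onI)
  have Wb[measurable]: "W \<in> sets borel" using W by (rule borel_open)
  have Hb[measurable]: "hyperplane k \<in> sets borel" unfolding hyperplane_def by measurable
  note [measurable] = B(1)
  \<comment> \<open>nothing is known about \<open>\<psi>\<close> outside of \<open>W\<close>; cutting it off makes it Borel measurable\<close>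
  define \<psi>0 where "\<psi>0 u = indicator W u *\<^sub>R \<psi> u" for u
  have [measurable]: "\<psi>0 \<in> borel_measurable borel"
    unfolding \<psi>0_def by (rule borel_measurable_continuous_on_indicator[OF Wb smooth_on_imp_continuous_on[OF sm]])
  have \<psi>0: "\<psi>0 u = \<psi> u" if "u \<in> W" for u using that by (simp add: \<psi>0_def)
  define D where "D u = det (\<chi> i. if i = k then \<psi> u else partial_deriv i \<psi> u)" for u
  define D0 where "D0 u = indicator W u *\<^sub>R D u" for u
  have "continuous_on W D"
  proof -
    have "continuous_on W (partial_deriv i \<psi>)" for i
      unfolding partial_deriv_def[abs_def]
      by (rule smooth_on_imp_continuous_on[OF smooth_on_frechet_derivative[OF sm]])
    then have c: "continuous_on W (\<lambda>u. (if i = k then \<psi> u else partial_deriv i \<psi> u) $ j)" for i j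
      using smooth_on_imp_continuous_on[OF sm] by (cases "i = k") (auto intro!: continuous_intros)
    show ?thesis
      unfolding D_def det_def by (simp only: vec_lambda_beta)
        (intro continuous_on_sum continuous_on_mult continuous_on_const continuous_on_prod c)
  qed
  then have [measurable]: "D0 \<in> borel_measurable borel"
    unfolding D0_def by (rule borel_measurable_continuous_on_indicator[OF Wb])
  have D0: "D0 u = D u" if "u \<in> W" for u using that by (simp add: D0_def)
  define U where "U = {u \<in> W \<inter> hyperplane k. \<psi> u \<in> B}"
  have U_eq: "U = {u \<in> W \<inter> hyperplane k. \<psi>0 u \<in> B}" using \<psi>0 by (auto simp: U_def)
  have U[measurable]: "U \<in> sets borel" unfolding U_eq by measurable
  have UD: "u \<in> W" "u \<in> W \<inter> hyperplane k" if "u \<in> U" for u using that by (auto simp: U_def)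
  \<comment> \<open>the points over the piece \<open>U\<close> of the hyperplane that \<open>\<Theta>\<close> maps into the shell\<close>
  define S where "S = {z. pr z \<in> U \<and> 1 \<le> exp (z $ k) * q (\<psi>0 (pr z)) \<and> exp (z $ k) * q (\<psi>0 (pr z)) \<le> 2}"
  have S[measurable]: "S \<in> sets borel" unfolding S_def by measurable
  define \<Theta> where "\<Theta> z = exp (z $ k) *\<^sub>R \<psi> (pr z)" for z
  have SD: "pr z \<in> U" "pr z \<in> W \<inter> hyperplane k" "\<psi>0 (pr z) = \<psi> (pr z)" if "z \<in> S" for z
    using that UD \<psi>0 by (auto simp: S_def)
  have f\<Theta>: "f (\<Theta> z) = exp (z $ k)" if "z \<in> S" for z
    using SD[OF that] f1 by (simp add: \<Theta>_def homogeneous)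
  have \<Theta>_image: "\<Theta> ` S = {y \<in> shell q. y /\<^sub>R f y \<in> B}"
  proof (intro equalityI subsetI)
    fix y assume "y \<in> \<Theta> ` S"
    then obtain z where z: "z \<in> S" "y = \<Theta> z" by blast
    have "y /\<^sub>R f y = \<psi> (pr z)" using f\<Theta>[OF z(1)] z by (simp add: \<Theta>_def)
    moreover have "q y = exp (z $ k) * q (\<psi> (pr z))" using z by (simp add: \<Theta>_def q.homogeneous)
    ultimately show "y \<in> {y \<in> shell q. y /\<^sub>R f y \<in> B}"
      using z SD[OF z(1)] by (auto simp: S_def shell_def U_def)
  next
    fix y assume "y \<in> {y \<in> shell q. y /\<^sub>R f y \<in> B}"
    then have y: "y \<in> shell q" "y /\<^sub>R f y \<in> B" by auto
    then have "y \<noteq> 0" using q.zero_notin_shell by metis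
    then have fy: "0 < f y" by (rule pos)
    obtain u where u: "u \<in> W \<inter> hyperplane k" "y /\<^sub>R f y = \<psi> u" using y(2) B(2) by blast
    have uk: "u $ k = 0" using u by (simp add: hyperplane_def)
    \<comment> \<open>since \<open>f (\<Theta> z) = exp z\<^sub>k\<close>, the point \<open>y\<close> can only be hit at height \<open>ln (f y)\<close>\<close>
    define z where "z = u + ln (f y) *\<^sub>R axis k 1"
    have zk: "exp (z $ k) = f y" using fy uk by (simp add: z_def)
    have prz: "pr z = u" using pr_shift pr_id u by (simp add: z_def)
    have \<Theta>z: "\<Theta> z = y" using fy by (simp add: \<Theta>_def zk prz u(2)[symmetric])
    have "u \<in> U" using u y by (simp add: U_def)
    moreover have "exp (z $ k) * q (\<psi> u) = q y"
      using fy q.homogeneous[of "f y" "\<psi> u"] by (simp add: zk u(2)[symmetric])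
    ultimately have "z \<in> S" using y(1) u by (simp add: S_def prz \<psi>0 shell_def)
    then show "y \<in> \<Theta> ` S" using \<Theta>z by blast
  qed
  have \<Theta>S: "\<Theta> ` S \<in> sets borel" unfolding \<Theta>_image by measurable
  have \<Theta>_inj: "inj_on \<Theta> S"
  proof (rule inj_onI)
    fix z z' assume z: "z \<in> S" "z' \<in> S" "\<Theta> z = \<Theta> z'"
    then have k: "z $ k = z' $ k" using f\<Theta> by (metis exp_inj_iff)
    then have "\<psi> (pr z) = \<psi> (pr z')" using z by (simp add: \<Theta>_def)
    then have "pr z = pr z'" using inj SD[OF z(1)] SD[OF z(2)] by (auto dest: inj_onD)
    then show "z = z'" using k by (simp add: pr_def)
  qed
  define \<Theta>' where "\<Theta>' z v = exp (z $ k) *\<^sub>R (frechet_derivative \<psi> (at (pr z)) (pr v) + (v $ k) *\<^sub>R \<psi> (pr z))" for z v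
  have \<Theta>_der: "(\<Theta> has_derivative \<Theta>' z) (at z within S)" if "z \<in> S" for z
  proof -
    have p: "(pr has_derivative pr) (at z)" by (rule bounded_linear_imp_has_derivative[OF pr_lin])
    have "((\<lambda>z. \<psi> (pr z)) has_derivative (\<lambda>v. frechet_derivative \<psi> (at (pr z)) (pr v))) (at z)"
      by (rule has_derivative_compose[OF p smooth_on_has_derivative[OF sm]]) (use SD[OF that] in auto)
    moreover have "((\<lambda>z. exp (z $ k)) has_derivative (\<lambda>v. exp (z $ k) * v $ k)) (at z)"
      by (auto intro!: derivative_eq_intros bounded_linear_imp_has_derivative bounded_linear_vec_nth)
    ultimately have "(\<Theta> has_derivative (\<lambda>v. exp (z $ k) *\<^sub>R frechet_derivative \<psi> (at (pr z)) (pr v) +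
        (exp (z $ k) * v $ k) *\<^sub>R \<psi> (pr z))) (at z)"
      unfolding \<Theta>_def[abs_def] by (rule has_derivative_scaleR[rotated])
    then have "(\<Theta> has_derivative \<Theta>' z) (at z)"
      by (simp add: \<Theta>'_def[abs_def] scaleR_add_right)
    then show ?thesis by (rule has_derivative_at_withinI)
  qed
  have \<Theta>_det: "det (matrix (\<Theta>' z)) = exp (z $ k) ^ n * D (pr z)" if "z \<in> S" for z
  proof -
    have lin: "linear (frechet_derivative \<psi> (at (pr z)))"
      using has_derivative_linear[OF smooth_on_has_derivative[OF sm]] SD[OF that] by blast
    have "\<Theta>' z (axis j 1) = exp (z $ k) *\<^sub>R (if j = k then \<psi> (pr z) else partial_deriv j \<psi> (pr z))" for j
    proof -
      have "pr (axis j 1) = (if j = k then 0 else axis j 1)"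
        by (auto simp: pr_def vec_eq_iff axis_def)
      then show ?thesis
        by (auto simp: \<Theta>'_def partial_deriv_def linear_0[OF lin] axis_def)
    qed
    \<comment> \<open>the images of the basis vectors are the columns of the Jacobian, but the rows in the volume form\<close>
    then have "matrix (\<Theta>' z) =
        transpose (\<chi> i. exp (z $ k) *s (if i = k then \<psi> (pr z) else partial_deriv i \<psi> (pr z)))"
      by (simp add: matrix_def transpose_def vec_eq_iff)
    then show ?thesis
      by (simp add: det_rows_mul D_def n_def)
  qed
  have meas: "(\<lambda>z. indicator S z * \<bar>det (matrix (\<Theta>' z))\<bar>) \<in> borel_measurable borel"
  proof -
    have "(\<lambda>z. indicator S z * \<bar>exp (z $ k) ^ n * D0 (pr z)\<bar>) \<in> borel_measurable borel"
      by measurable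
    moreover have "(\<lambda>z. indicator S z * \<bar>exp (z $ k) ^ n * D0 (pr z)\<bar>) = (\<lambda>z. indicator S z * \<bar>det (matrix (\<Theta>' z))\<bar>)"
      using \<Theta>_det D0 SD by (fastforce simp: indicator_def)
    ultimately show ?thesis by simp
  qed
  \<comment> \<open>the transformed integrand, from which the radial coordinate has cancelled\<close>
  define \<Phi> where "\<Phi> u = \<bar>D0 u\<bar> * (cone_density f (\<psi>0 u) / ln 2)" for u
  have [measurable]: "\<Phi> \<in> borel_measurable borel" unfolding \<Phi>_def by measurable
  have \<Phi>_nonneg: "0 \<le> \<Phi> u" for u using cone_density_nonneg by (simp add: \<Phi>_def)
  have integrand: "ennreal \<bar>det (matrix (\<Theta>' z))\<bar> * ennreal (cone_density f (\<Theta> z) / ln 2) = ennreal (\<Phi> (pr z))"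
    if "z \<in> S" for z
  proof -
    have 1: "cone_density f (\<Theta> z) = cone_density f (\<psi> (pr z)) / exp (z $ k) ^ n"
      using f1 nz SD[OF that] f\<Theta>[OF that] fundamental_tensor_homogeneous[of "exp (z $ k)" "\<psi> (pr z)"]
      by (simp add: cone_density_def n_def \<Theta>_def)
    have "\<bar>det (matrix (\<Theta>' z))\<bar> * (cone_density f (\<Theta> z) / ln 2) = \<Phi> (pr z)"
      unfolding 1 \<Theta>_det[OF that] using D0 SD[OF that] by (simp add: \<Phi>_def abs_mult)
    then show ?thesis using cone_density_nonneg by (simp flip: ennreal_mult)
  qed
  have \<Phi>_form: "ln 2 * \<Phi> u = \<bar>indicatrix_form f (\<psi> u) k (\<lambda>j. partial_deriv j \<psi> u)\<bar>" if "u \<in> U" for u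
  proof -
    note u = UD[OF that]
    have "indicatrix_form f (\<psi> u) k (\<lambda>j. partial_deriv j \<psi> u) = sqrt (det (fundamental_tensor f (\<psi> u))) * D u"
      by (simp add: indicatrix_form_def D_def f1[OF u(2)] if_distrib cong: if_cong)
    then show ?thesis
      using f1 u nz det_pos[of "\<psi> u"] D0 \<psi>0 by (simp add: \<Phi>_def cone_density_def abs_mult less_imp_le)
  qed
  have "emeasure (cone_measure q f) B = (\<integral>\<^sup>+y\<in>\<Theta> ` S. ennreal (cone_density f y / ln 2) \<partial>lborel)"
    unfolding \<Theta>_image by (rule emeasure_cone_measure[OF q B(1) BI])
  also have "\<dots> = (\<integral>\<^sup>+z\<in>S. ennreal \<bar>det (matrix (\<Theta>' z))\<bar> * ennreal (cone_density f (\<Theta> z) / ln 2) \<partial>lborel)"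
    by (rule nn_integral_change_of_variables[OF S \<Theta>S \<Theta>_der \<Theta>_inj meas]) measurable
  also have "\<dots> = (\<integral>\<^sup>+z. ennreal (\<Phi> (pr z)) * indicator S z \<partial>lborel)"
    using integrand by (intro nn_integral_cong) (auto simp: indicator_def)
  also have "\<dots> = (\<integral>\<^sup>+u. (\<integral>\<^sup>+r. ennreal (\<Phi> (pr (u + r *\<^sub>R axis k 1))) * indicator S (u + r *\<^sub>R axis k 1) \<partial>lborel) \<partial>hyperplane_lborel k)"
    by (rule nn_integral_lborel_hyperplane) measurable
  also have "\<dots> = (\<integral>\<^sup>+u. ennreal (ln 2 * \<Phi> u) * indicator U u \<partial>hyperplane_lborel k)"
  proof (rule nn_integral_cong_AE, rule AE_mp[OF AE_hyperplane_lborel], intro AE_I2 impI)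
    fix u assume u: "u \<in> hyperplane k"
    show "(\<integral>\<^sup>+r. ennreal (\<Phi> (pr (u + r *\<^sub>R axis k 1))) * indicator S (u + r *\<^sub>R axis k 1) \<partial>lborel) =
        ennreal (ln 2 * \<Phi> u) * indicator U u"
    proof (cases "u \<in> U")
      case True
      then have qu: "0 < q (\<psi>0 u)" using UD nz q.positive \<psi>0 by metis
      have "(indicator S (u + r *\<^sub>R axis k 1) :: ennreal) =
          indicator {r. 1 \<le> exp (0 + r) * q (\<psi>0 u) \<and> exp (0 + r) * q (\<psi>0 u) \<le> 2} r" for r
        using True u by (simp add: S_def indicator_def pr_shift pr_id hyperplane_def)
      then have "(\<integral>\<^sup>+r. ennreal (\<Phi> (pr (u + r *\<^sub>R axis k 1))) * indicator S (u + r *\<^sub>R axis k 1) \<partial>lborel) =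
          (\<integral>\<^sup>+r. ennreal (\<Phi> u) * indicator {r. 1 \<le> exp (0 + r) * q (\<psi>0 u) \<and> exp (0 + r) * q (\<psi>0 u) \<le> 2} r \<partial>lborel)"
        using u by (simp add: pr_shift pr_id)
      also have "\<dots> = ennreal (\<Phi> u) * ennreal (ln 2)"
        using q.log_length[OF qu, of 0] by (subst nn_integral_cmult) measurable
      finally show ?thesis using True \<Phi>_nonneg by (simp add: mult.commute flip: ennreal_mult)
    next
      case False
      then have "indicator S (u + r *\<^sub>R axis k 1) = (0 :: ennreal)" for r
        using u by (simp add: S_def indicator_def pr_shift pr_id)
      then show ?thesis using False by simp
    qed
  qed
  also have "\<dots> = (\<integral>\<^sup>+u\<in>U. ennreal \<bar>indicatrix_form f (\<psi> u) k (\<lambda>j. partial_deriv j \<psi> u)\<bar> \<partial>hyperplane_lborel k)"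
    using \<Phi>_form by (intro nn_integral_cong) (auto simp: indicator_def)
  finally show ?thesis unfolding U_def .
qed

end

section \<open>Averages over the indicatrix\<close>

text \<open>The defining property of \<open>indicatrix_measure\<close>, named so that existence and uniqueness can be stated
separately.\<close>

definition is_indicatrix_measure :: "(real^'n::finite \<Rightarrow> real) \<Rightarrow> (real^'n) measure \<Rightarrow> bool" where
  "is_indicatrix_measure f \<mu> \<longleftrightarrow> sets \<mu> = sets (restrict_space borel (indicatrix f)) \<and>
     (\<forall>k W \<psi> B. local_parametrization (indicatrix f) k W \<psi> \<and> B \<in> sets borel \<and>
            B \<subseteq> \<psi> ` (W \<inter> hyperplane k) \<longrightarrow>
          emeasure \<mu> B =
            (\<integral>\<^sup>+u\<in>{u \<in> W \<inter> hyperplane k. \<psi> u \<in> B}.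
               ennreal \<bar>indicatrix_form f (\<psi> u) k (\<lambda>j. partial_deriv j \<psi> u)\<bar> \<partial>hyperplane_lborel k))"

lemma is_indicatrix_measureD:
  assumes "is_indicatrix_measure f \<mu>" "local_parametrization (indicatrix f) k W \<psi>"
    "B \<in> sets borel" "B \<subseteq> \<psi> ` (W \<inter> hyperplane k)"
  shows "emeasure \<mu> B =
    (\<integral>\<^sup>+u\<in>{u \<in> W \<inter> hyperplane k. \<psi> u \<in> B}.
       ennreal \<bar>indicatrix_form f (\<psi> u) k (\<lambda>j. partial_deriv j \<psi> u)\<bar> \<partial>hyperplane_lborel k)"
  using assms unfolding is_indicatrix_measure_def by simp

lemma indicatrix_measure_eq_The: "indicatrix_measure f = (THE \<mu>. is_indicatrix_measure f \<mu>)"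
  unfolding indicatrix_measure_def is_indicatrix_measure_def ..

lemma emeasure_eq_on_finite_cover:
  assumes sets: "sets M = sets N" and fin: "finite C" and C: "C \<subseteq> sets M"
    and eq: "\<And>c B. c \<in> C \<Longrightarrow> B \<in> sets M \<Longrightarrow> B \<subseteq> c \<Longrightarrow> emeasure M B = emeasure N B"
    and B: "B \<in> sets M" "B \<subseteq> \<Union>C"
  shows "emeasure M B = emeasure N B"
  using fin C eq B
proof (induction C arbitrary: B rule: finite_induct)
  case empty
  then show ?case by simp
next
  case (insert c C)
  have c: "c \<in> sets M" using insert.prems by simp
  have m: "B \<inter> c \<in> sets M" "B - c \<in> sets M" using insert.prems c by auto
  have B: "B = (B \<inter> c) \<union> (B - c)" by auto
  have "emeasure M B = emeasure M (B \<inter> c) + emeasure M (B - c)"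
    using plus_emeasure[OF m] B by (metis Diff_disjoint Int_Diff inf_commute Int_assoc)
  also have "emeasure M (B \<inter> c) = emeasure N (B \<inter> c)"
    using insert.prems(2)[of c "B \<inter> c"] m by simp
  also have "emeasure M (B - c) = emeasure N (B - c)"
    using insert.IH[of "B - c"] insert.prems m by blast
  also have "emeasure N (B \<inter> c) + emeasure N (B - c) = emeasure N B"
    using plus_emeasure[of "B \<inter> c" N "B - c"] m sets B by (metis Diff_disjoint Int_Diff inf_commute Int_assoc)
  finally show ?case .
qed

context minkowski_norm
begin

text \<open>The half space \<open>0 < \<sigma> * y\<^sub>k\<close> is the cone over the affine hyperplane \<open>y\<^sub>k = \<sigma>\<close>; projecting this
hyperplane radially to the indicatrix parametrizes the part of the indicatrix in the half space. Along
the hyperplane, the \<open>k\<close>-th component of \<open>\<psi>\<close> determines the radial factor, and the same holds for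
derivatives; both injectivity claims follow by comparing \<open>k\<close>-th components first.\<close>

lemma radial_chart:
  fixes \<sigma> :: real and k :: 'n
  assumes \<sigma>: "\<sigma> = 1 \<or> \<sigma> = - 1"
  defines "a \<equiv> \<sigma> *\<^sub>R axis k 1"
  defines "\<psi> \<equiv> \<lambda>u. inverse (f (a + u)) *\<^sub>R (a + u)"
  shows "local_parametrization (indicatrix f) k (- {- a}) \<psi>"
    and "{y \<in> indicatrix f. 0 < \<sigma> * y $ k} \<subseteq> \<psi> ` (- {- a} \<inter> hyperplane k)"
proof -
  have ak: "(a + u) $ k = \<sigma>" if "u \<in> hyperplane k" for u
    using that by (simp add: a_def hyperplane_def)
  have nz: "a + u \<noteq> 0" if "u \<in> - {- a}" for u
    using that by (auto simp: add_eq_0_iff)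
  have op: "open (- {- a})" by (simp add: open_Compl)
  have sf: "smooth_on (- {- a}) (\<lambda>u. inverse (f (a + u)))"
    using smooth_on_compose_affine[OF op smooth bounded_linear_ident, of a] nz pos
    by (intro smooth_on_inverse op) (auto simp: less_le)
  have sm: "smooth_on (- {- a}) \<psi>"
    unfolding \<psi>_def by (intro smooth_on_scaleR op sf smooth_on_affine bounded_linear_ident)
  show "local_parametrization (indicatrix f) k (- {- a}) \<psi>"
    unfolding local_parametrization_def
  proof (intro conjI ballI op sm)
    show "inj_on \<psi> (- {- a} \<inter> hyperplane k)"
    proof (rule inj_onI)
      fix u v assume uv: "u \<in> - {- a} \<inter> hyperplane k" "v \<in> - {- a} \<inter> hyperplane k" "\<psi> u = \<psi> v"
      have "inverse (f (a + u)) * \<sigma> = inverse (f (a + v)) * \<sigma>"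
        using arg_cong[OF uv(3), of "\<lambda>y. y $ k"] ak[of u] ak[of v] uv(1,2) by (simp add: \<psi>_def)
      then have "inverse (f (a + u)) = inverse (f (a + v))" using \<sigma> by auto
      moreover have "inverse (f (a + u)) \<noteq> 0" using nz pos uv(1) by (simp add: less_le)
      ultimately show "u = v" using uv(3) by (simp add: \<psi>_def)
    qed
    show "\<psi> ` (- {- a} \<inter> hyperplane k) \<subseteq> indicatrix f"
      using normalize_in_indicatrix nz by (auto simp: \<psi>_def)
    fix u assume u: "u \<in> - {- a} \<inter> hyperplane k"
    let ?c = "frechet_derivative (\<lambda>u. inverse (f (a + u))) (at u)"
    have "((\<lambda>u. a + u) has_derivative (\<lambda>v. v)) (at u)"
      by (auto intro!: derivative_eq_intros)
    then have "(\<psi> has_derivative (\<lambda>v. inverse (f (a + u)) *\<^sub>R v + ?c v *\<^sub>R (a + u))) (at u)"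
      unfolding \<psi>_def using u smooth_on_has_derivative[OF sf, of u]
      by (intro has_derivative_scaleR) auto
    then have d: "frechet_derivative \<psi> (at u) = (\<lambda>v. inverse (f (a + u)) *\<^sub>R v + ?c v *\<^sub>R (a + u))"
      by (rule frechet_derivative_at[symmetric])
    show "inj_on (frechet_derivative \<psi> (at u)) (hyperplane k)"
    proof (rule inj_onI)
      fix v w assume vw: "v \<in> hyperplane k" "w \<in> hyperplane k"
        "frechet_derivative \<psi> (at u) v = frechet_derivative \<psi> (at u) w"
      have "?c v * \<sigma> = ?c w * \<sigma>"
        using arg_cong[OF vw(3), of "\<lambda>y. y $ k"] vw(1,2) ak[of u] u by (simp add: d hyperplane_def)
      then have "?c v = ?c w" using \<sigma> by auto
      then have "inverse (f (a + u)) *\<^sub>R v = inverse (f (a + u)) *\<^sub>R w"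
        using vw(3) by (simp add: d)
      moreover have "inverse (f (a + u)) \<noteq> 0" using nz pos u by (simp add: less_le)
      ultimately show "v = w" by simp
    qed
  qed
  show "{y \<in> indicatrix f. 0 < \<sigma> * y $ k} \<subseteq> \<psi> ` (- {- a} \<inter> hyperplane k)"
  proof
    fix y assume "y \<in> {y \<in> indicatrix f. 0 < \<sigma> * y $ k}"
    then have y: "f y = 1" "0 < \<sigma> * y $ k" by (auto simp: indicatrix_def)
    define m where "m = \<sigma> * y $ k"
    have m: "0 < m" using y by (simp add: m_def)
    define u where "u = inverse m *\<^sub>R y - a"
    have au: "a + u = inverse m *\<^sub>R y" by (simp add: u_def)
    have "f (a + u) = inverse m"
      unfolding au using y m homogeneous[of "inverse m" y] by simp
    then have "\<psi> u = y" using m by (simp add: \<psi>_def au)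
    moreover have "u \<in> hyperplane k"
      using y(2) \<sigma> by (auto simp: hyperplane_def u_def a_def m_def)
    moreover have "u \<noteq> - a"
    proof
      assume "u = - a"
      then have "inverse m *\<^sub>R y = 0" using au by simp
      with y(1) m zero show False by auto
    qed
    ultimately show "y \<in> \<psi> ` (- {- a} \<inter> hyperplane k)" by blast
  qed
qed

text \<open>The measure of a subset of one of the \<open>2n\<close> radial charts is prescribed, and these charts cover the
indicatrix because it does not contain the origin.\<close>

lemma is_indicatrix_measure_unique:
  assumes "is_indicatrix_measure f \<mu>" "is_indicatrix_measure f \<nu>"
  shows "\<mu> = \<nu>"
proof (rule measure_eqI)
  have s\<mu>: "sets \<mu> = sets (restrict_space borel (indicatrix f))" and
    s\<nu>: "sets \<nu> = sets (restrict_space borel (indicatrix f))"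
    using assms by (auto simp: is_indicatrix_measure_def)
  show s: "sets \<mu> = sets \<nu>" by (simp add: s\<mu> s\<nu>)
  define c where "c = (\<lambda>(k, \<sigma>). {y \<in> indicatrix f. (0::real) < \<sigma> * y $ k})"
  let ?C = "c ` (UNIV \<times> {1, - 1})"
  fix B assume B: "B \<in> sets \<mu>"
  have BI: "B \<subseteq> indicatrix f" "B \<in> sets borel"
    using B indicatrix_measurable by (auto simp: s\<mu> sets_restrict_space_iff)
  show "emeasure \<mu> B = emeasure \<nu> B"
  proof (rule emeasure_eq_on_finite_cover[OF s, of ?C])
    have "c ks \<in> sets borel" for ks
    proof -
      have "c ks = indicatrix f \<inter> {y. 0 < snd ks * y $ fst ks}" by (auto simp: c_def split: prod.splits)
      moreover have "{y. 0 < snd ks * y $ fst ks} \<in> sets borel" by measurable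
      ultimately show ?thesis using indicatrix_measurable by simp
    qed
    then show "?C \<subseteq> sets \<mu>"
      using indicatrix_measurable by (auto simp: s\<mu> sets_restrict_space_iff c_def)
    show "B \<subseteq> \<Union>?C"
    proof
      fix y assume "y \<in> B"
      then have y: "y \<in> indicatrix f" using BI by blast
      then have "y \<noteq> 0" using zero by (auto simp: indicatrix_def)
      then obtain k where "y $ k \<noteq> 0" by (auto simp: vec_eq_iff)
      then have "0 < 1 * y $ k \<or> 0 < - 1 * y $ k" by auto
      then have "y \<in> c (k, 1) \<or> y \<in> c (k, - 1)" using y by (simp add: c_def)
      then show "y \<in> \<Union>?C" by blast
    qed
    fix d B assume "d \<in> ?C" "B \<in> sets \<mu>" "B \<subseteq> d"
    then obtain k \<sigma> where ks: "\<sigma> = 1 \<or> \<sigma> = - 1" "d = c (k, \<sigma>)" by auto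
    have B: "B \<in> sets borel"
      using \<open>B \<in> sets \<mu>\<close> indicatrix_measurable by (auto simp: s\<mu> sets_restrict_space_iff)
    note chart = radial_chart[OF ks(1), of k]
    have "B \<subseteq> (\<lambda>u. inverse (f (\<sigma> *\<^sub>R axis k 1 + u)) *\<^sub>R (\<sigma> *\<^sub>R axis k 1 + u)) `
        (- {- (\<sigma> *\<^sub>R axis k 1)} \<inter> hyperplane k)"
      using chart(2) \<open>B \<subseteq> d\<close> ks(2) unfolding c_def by auto
    from is_indicatrix_measureD[OF assms(1) chart(1) B this] is_indicatrix_measureD[OF assms(2) chart(1) B this]
    show "emeasure \<mu> B = emeasure \<nu> B" by (rule trans[OF _ sym])
  qed (use B in auto)
qed

lemma is_indicatrix_measure_cone_measure:
  assumes "gauge q" shows "is_indicatrix_measure f (cone_measure q f)"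
  unfolding is_indicatrix_measure_def
  using cone_measure_local_parametrization[OF assms] by (auto simp: cone_measure_def)

lemma indicatrix_measure_eq_cone_measure:
  assumes "gauge q" shows "indicatrix_measure f = cone_measure q f"
  unfolding indicatrix_measure_eq_The
  using is_indicatrix_measure_cone_measure[OF assms] is_indicatrix_measure_unique by blast

lemma integral_indicatrix_measure:
  assumes q: "gauge q" and cont: "continuous_on (- {0}) \<phi>"
    and hom: "\<And>t y. 0 < t \<Longrightarrow> y \<noteq> 0 \<Longrightarrow> \<phi> (t *\<^sub>R y) = (\<phi> y :: real)"
  shows "(\<integral>y. \<phi> y \<partial>indicatrix_measure f) = (LINT y:shell q|lborel. \<phi> y * cone_density f y) / ln 2"
proof -
  interpret q: gauge q by (rule q)
  let ?S = "restrict_space lborel (shell q)"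
  have sub: "shell q \<subseteq> - {0}" using q.zero_notin_shell by auto
  have "indicatrix f \<subseteq> - {0}" using zero by (auto simp: indicatrix_def)
  then have \<phi>I: "\<phi> \<in> borel_measurable (restrict_space borel (indicatrix f))"
    by (intro borel_measurable_continuous_on_restrict continuous_on_subset[OF cont])
  have n: "(\<lambda>y. y /\<^sub>R f y) \<in> density ?S (\<lambda>y. ennreal (cone_density f y / ln 2)) \<rightarrow>\<^sub>M restrict_space borel (indicatrix f)"
    using normalize_measurable_indicatrix[OF q] by (simp add: measurable_def space_restrict_space sets_restrict_space)
  have "(\<integral>y. \<phi> y \<partial>indicatrix_measure f) = (\<integral>y. \<phi> (y /\<^sub>R f y) \<partial>density ?S (\<lambda>y. ennreal (cone_density f y / ln 2)))"
    unfolding indicatrix_measure_eq_cone_measure[OF q] cone_measure_def by (rule integral_distr[OF n \<phi>I])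
  also have "\<dots> = (\<integral>y. (cone_density f y / ln 2) *\<^sub>R \<phi> (y /\<^sub>R f y) \<partial>?S)"
  proof (rule integral_density)
    show "(\<lambda>y. \<phi> (y /\<^sub>R f y)) \<in> borel_measurable ?S"
      using measurable_compose[OF n \<phi>I] by simp
    show "(\<lambda>y. cone_density f y / ln 2) \<in> borel_measurable ?S"
      by (intro measurable_restrict_space1) measurable
  qed (simp add: cone_density_nonneg)
  also have "\<dots> = (\<integral>y. \<phi> y * cone_density f y / ln 2 \<partial>?S)"
  proof (rule Bochner_Integration.integral_cong[OF refl])
    fix y assume "y \<in> space ?S"
    then have "y \<noteq> 0" using sub by (auto simp: space_restrict_space)
    then show "(cone_density f y / ln 2) *\<^sub>R \<phi> (y /\<^sub>R f y) = \<phi> y * cone_density f y / ln 2"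
      using hom[of "inverse (f y)" y] pos[of y] by simp
  qed
  also have "\<dots> = (LINT y:shell q|lborel. \<phi> y * cone_density f y / ln 2)"
    unfolding set_lebesgue_integral_def by (subst integral_restrict_space) simp_all
  also have "\<dots> = (LINT y:shell q|lborel. \<phi> y * cone_density f y) / ln 2"
    by simp
  finally show ?thesis .
qed

text \<open>The left hand side does not involve \<open>q\<close>, so the quotient may be evaluated on whichever shell suits the
purpose: one that stays fixed while \<open>f\<close> varies, or one that a given linear map straightens.\<close>

lemma indicatrix_average_eq:
  assumes q: "gauge q" and cont: "continuous_on (- {0}) \<phi>"
    and hom: "\<And>t y. 0 < t \<Longrightarrow> y \<noteq> 0 \<Longrightarrow> \<phi> (t *\<^sub>R y) = \<phi> y"
  shows "indicatrix_average f \<phi> =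
    (LINT y:shell q|lborel. \<phi> y * cone_density f y) / (LINT y:shell q|lborel. cone_density f y)"
proof -
  have "space (indicatrix_measure f) = indicatrix f"
    by (simp add: indicatrix_measure_eq_cone_measure[OF q] cone_measure_def space_restrict_space)
  then have "measure (indicatrix_measure f) (indicatrix f) = (\<integral>y. 1 \<partial>indicatrix_measure f)"
    by simp
  also have "\<dots> = (LINT y:shell q|lborel. cone_density f y) / ln 2"
    using integral_indicatrix_measure[OF q, of "\<lambda>_. 1"] by simp
  finally show ?thesis
    unfolding indicatrix_average_def by (simp add: integral_indicatrix_measure[OF q cont hom])
qed

end

lemma gauge_norm: "gauge (norm :: real^'n::finite \<Rightarrow> real)"
  by standard (auto intro!: continuous_intros)

lemma gauge_norm_linear:
  fixes L :: "real^'n::finite \<Rightarrow> real^'n"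
  assumes "linear L" "inj L" shows "gauge (\<lambda>y. norm (L y))"
proof
  have "bounded_linear L" using assms by (simp add: linear_linear)
  then show "continuous_on UNIV (\<lambda>y. norm (L y))"
    by (intro continuous_on_norm linear_continuous_on)
  show "norm (L (t *\<^sub>R y)) = t * norm (L y)" if "0 \<le> t" for t y
    using that assms by (simp add: linear_cmul)
  show "0 < norm (L y)" if "y \<noteq> 0" for y
    using that assms by (metis injD linear_0 zero_less_norm_iff)
qed

lemma compact_shell_norm: "compact (shell (norm :: real^'n::finite \<Rightarrow> real))"
proof -
  have "shell (norm :: real^'n \<Rightarrow> real) = cball 0 2 - ball 0 1"
    by (auto simp: shell_def)
  then show ?thesis by (simp add: compact_diff)
qed

lemma shell_norm_subset: "shell norm \<subseteq> - {0}"
  by (auto simp: shell_def)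

lemma integral_shell_norm_pos:
  fixes h :: "real^'n::finite \<Rightarrow> real"
  assumes cont: "continuous_on (- {0}) h" and pos: "\<And>y. y \<noteq> 0 \<Longrightarrow> 0 < h y"
  shows "0 < (LINT y:shell norm|lborel. h y)"
proof -
  let ?K = "shell norm :: (real^'n) set"
  have ball: "ball ((3/2) *\<^sub>R axis k 1) (1/2) \<subseteq> ?K" for k :: 'n
  proof
    fix y :: "real^'n" assume "y \<in> ball ((3/2) *\<^sub>R axis k 1) (1/2)"
    then have "norm ((3/2) *\<^sub>R axis k 1 - y) < 1/2" by (simp add: dist_norm)
    moreover have "norm ((3/2) *\<^sub>R axis k (1::real)) = 3/2" by (simp add: norm_axis_1)
    ultimately show "y \<in> ?K"
      unfolding shell_def
      using norm_triangle_ineq2[of "(3/2) *\<^sub>R axis k 1" y] norm_triangle_ineq2[of y "(3/2) *\<^sub>R axis k 1"]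
      by (simp add: norm_minus_commute)
  qed
  have hK: "continuous_on ?K h" using cont shell_norm_subset by (rule continuous_on_subset)
  have ne: "?K \<noteq> {}" using ball by fastforce
  obtain y0 where y0: "y0 \<in> ?K" "\<And>y. y \<in> ?K \<Longrightarrow> h y0 \<le> h y"
    using continuous_attains_inf[OF compact_shell_norm ne hK] by blast
  have Kb: "?K \<in> sets borel" using compact_shell_norm compact_imp_closed borel_closed by blast
  have Kf: "?K \<in> fmeasurable lborel"
    using compact_shell_norm by (rule fmeasurable_compact)
  have "0 < measure lborel (ball ((3/2) *\<^sub>R axis undefined 1 :: real^'n) (1/2))"
    by (rule content_ball_pos) simp
  also have "\<dots> \<le> measure lborel ?K"
    using ball Kf by (intro measure_mono_fmeasurable) auto
  finally have "0 < h y0 * measure lborel ?K"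
    using pos[of y0] y0(1) shell_norm_subset by (auto intro!: mult_pos_pos)
  also have "\<dots> = (LINT y:?K|lborel. h y0)"
    using Kb by (simp add: set_lebesgue_integral_def)
  also have "\<dots> \<le> (LINT y:?K|lborel. h y)"
    using y0(2) by (intro set_integral_mono set_integrable_continuous_compact compact_shell_norm hK continuous_on_const)
  finally show ?thesis .
qed

lemma integral_lborel_linear:
  fixes L :: "real^'n::finite \<Rightarrow> real^'n" and h :: "real^'n \<Rightarrow> real"
  assumes L: "linear L" "inj L" and h[measurable]: "h \<in> borel_measurable borel"
  shows "(\<integral>z. h z \<partial>lborel) = (\<integral>y. \<bar>det (matrix L)\<bar> * h (L y) \<partial>lborel)"
proof -
  have "bounded_linear L" using L by (simp add: linear_linear)
  then have [measurable]: "L \<in> borel_measurable borel"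
    by (simp add: linear_continuous_on borel_measurable_continuous_onI)
  have "(\<integral>z. h z \<partial>lborel) = (\<integral>z. h z \<partial>density (distr lborel borel L) (\<lambda>_. ennreal \<bar>det (matrix L)\<bar>))"
    using lborel_linear[OF L] by simp
  also have "\<dots> = (\<integral>z. \<bar>det (matrix L)\<bar> *\<^sub>R h z \<partial>distr lborel borel L)"
    by (rule integral_density) simp_all
  also have "\<dots> = (\<integral>y. \<bar>det (matrix L)\<bar> *\<^sub>R h (L y) \<partial>lborel)"
    by (rule integral_distr) simp_all
  finally show ?thesis by simp
qed

text \<open>The isotropic average metric in the coordinates of a chart, as a function of the Minkowski norm \<open>f\<close> of
the tangent space in these coordinates.\<close>

definition average_form :: "(real^'n::finite \<Rightarrow> real) \<Rightarrow> real^'n \<Rightarrow> real^'n \<Rightarrow> real" where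
  "average_form f u v =
     (\<Sum>i\<in>UNIV. \<Sum>j\<in>UNIV. indicatrix_average f (\<lambda>y. fundamental_tensor f y $ i $ j) * u $ i * v $ j)"

context minkowski_norm
begin

lemma continuous_on_fundamental_form: "continuous_on (- {0}) (\<lambda>y. u \<bullet> (fundamental_tensor f y *v v))"
  unfolding inner_vec_def matrix_vector_mult_def
  by (simp, intro continuous_intros smooth_on_imp_continuous_on smooth_fundamental_tensor)

lemma average_form_eq_norm:
  "average_form f u v =
    (LINT y:shell norm|lborel. u \<bullet> (fundamental_tensor f y *v v) * cone_density f y) /
    (LINT y:shell norm|lborel. cone_density f y)"
proof -
  let ?g = "\<lambda>i j y. fundamental_tensor f y $ i $ j * cone_density f y"
  have int: "set_integrable lborel (shell norm) (\<lambda>y. c * ?g i j y)" for c i j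
    by (intro set_integrable_continuous_compact compact_shell_norm continuous_on_mult continuous_on_const
        continuous_on_subset[OF _ shell_norm_subset] continuous_on_cone_density
        smooth_on_imp_continuous_on[OF smooth_fundamental_tensor])
  have "(LINT y:shell norm|lborel. u \<bullet> (fundamental_tensor f y *v v) * cone_density f y) =
      (LINT y:shell norm|lborel. (\<Sum>i\<in>UNIV. \<Sum>j\<in>UNIV. (u $ i * v $ j) * ?g i j y))"
    by (simp add: inner_vec_def matrix_vector_mult_def sum_distrib_left sum_distrib_right mult_ac)
  also have "\<dots> = (\<Sum>i\<in>UNIV. \<Sum>j\<in>UNIV. (LINT y:shell norm|lborel. (u $ i * v $ j) * ?g i j y))"
    unfolding set_lebesgue_integral_def scaleR_sum_right
    by (intro trans[OF Bochner_Integration.integral_sum] sum.cong refl Bochner_Integration.integrable_sum int[unfolded set_integrable_def])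
  also have "\<dots> = (\<Sum>i\<in>UNIV. \<Sum>j\<in>UNIV. (u $ i * v $ j) * (LINT y:shell norm|lborel. ?g i j y))"
    by simp
  finally show ?thesis
    unfolding average_form_def
    by (subst indicatrix_average_eq[OF gauge_norm])
      (simp_all add: smooth_on_imp_continuous_on[OF smooth_fundamental_tensor] fundamental_tensor_homogeneous
        sum_divide_distrib mult_ac)
qed

lemma average_form_eq_average:
  "average_form f u v = indicatrix_average f (\<lambda>y. u \<bullet> (fundamental_tensor f y *v v))"
  unfolding average_form_eq_norm
  by (rule indicatrix_average_eq[OF gauge_norm continuous_on_fundamental_form, symmetric])
    (simp add: fundamental_tensor_homogeneous)

lemma average_form_sym: "average_form f u v = average_form f v u"
proof -
  have "u \<bullet> (fundamental_tensor f y *v v) = v \<bullet> (fundamental_tensor f y *v u)" if "y \<noteq> 0" for y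
  proof -
    have "transpose (fundamental_tensor f y) = fundamental_tensor f y"
      using fundamental_tensor_sym[OF that] by (simp add: transpose_def vec_eq_iff)
    then have "u v* fundamental_tensor f y = fundamental_tensor f y *v u"
      by (metis transpose_matrix_vector)
    then show ?thesis by (metis dot_lmul_matrix inner_commute)
  qed
  then have "u \<bullet> (fundamental_tensor f y *v v) = v \<bullet> (fundamental_tensor f y *v u)" if "y \<in> shell norm" for y
    using that shell_norm_subset by blast
  then have "(LINT y:shell norm|lborel. u \<bullet> (fundamental_tensor f y *v v) * cone_density f y) =
      (LINT y:shell norm|lborel. v \<bullet> (fundamental_tensor f y *v u) * cone_density f y)"
    using gauge.shell_measurable[OF gauge_norm] by (intro set_lebesgue_integral_cong) auto
  then show ?thesis by (simp add: average_form_eq_norm)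
qed

lemma cone_density_pos: "y \<noteq> 0 \<Longrightarrow> 0 < cone_density f y"
  using pos[of y] det_pos[of y] by (simp add: cone_density_def)

lemma integral_cone_density_pos: "0 < (LINT y:shell norm|lborel. cone_density f y)"
  by (rule integral_shell_norm_pos[OF continuous_on_cone_density cone_density_pos])

lemma average_form_pos: "u \<noteq> 0 \<Longrightarrow> 0 < average_form f u u"
  unfolding average_form_eq_norm
  by (intro divide_pos_pos integral_cone_density_pos integral_shell_norm_pos continuous_on_mult
      continuous_on_fundamental_form continuous_on_cone_density mult_pos_pos posdef cone_density_pos)

end

text \<open>Use the gauge \<open>\<lambda>y. norm (L y)\<close> for \<open>f\<close> and \<open>norm\<close> for \<open>f'\<close>, so that \<open>L\<close> maps one shell onto the other. The
density of \<open>f\<close> is \<open>\<bar>det L\<bar>\<close> times that of \<open>f'\<close>, which is exactly the Jacobian factor of the linear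
change of variables.\<close>

lemma average_form_linear:
  fixes f f' :: "real^'n::finite \<Rightarrow> real" and L :: "real^'n \<Rightarrow> real^'n"
  assumes f: "minkowski_norm f" and f': "minkowski_norm f'"
    and L: "linear L" "inj L" and fL: "\<And>y. f y = f' (L y)"
  shows "average_form f u v = average_form f' (L u) (L v)"
proof -
  interpret f: minkowski_norm f by (rule f)
  interpret f': minkowski_norm f' by (rule f')
  let ?q = "\<lambda>y. norm (L y)"
  note q = gauge_norm_linear[OF L]
  have nz: "L y \<noteq> 0" if "y \<noteq> 0" for y using L that by (metis injD linear_0)
  have dens: "cone_density f y = \<bar>det (matrix L)\<bar> * cone_density f' (L y)" if "y \<noteq> 0" for y
    unfolding cone_density_def fundamental_tensor_linear(2)[OF f'.smooth_square L fL that]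
    by (simp add: fL real_sqrt_mult)
  have transform: "(LINT y:shell ?q|lborel. \<phi> y * cone_density f y) = (LINT z:shell norm|lborel. \<phi>' z * cone_density f' z)"
    if c: "continuous_on (- {0}) \<phi>'" and \<phi>: "\<And>y. y \<noteq> 0 \<Longrightarrow> \<phi> y = \<phi>' (L y)" for \<phi> \<phi>'
  proof -
    have m: "(\<lambda>z. \<phi>' z * cone_density f' z) \<in> borel_measurable borel"
    proof (rule f'.measurable_off_zero)
      show "continuous_on (- {0}) (\<lambda>z. \<phi>' z * cone_density f' z)"
        by (intro continuous_on_mult c f'.continuous_on_cone_density)
    qed (simp add: cone_density_def f'.zero)
    have sb: "shell (norm :: real^'n \<Rightarrow> real) \<in> sets borel"
      using gauge.shell_measurable[OF gauge_norm] .
    have "(LINT z:shell norm|lborel. \<phi>' z * cone_density f' z) =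
        (\<integral>y. \<bar>det (matrix L)\<bar> * (indicator (shell norm) (L y) *\<^sub>R (\<phi>' (L y) * cone_density f' (L y))) \<partial>lborel)"
      unfolding set_lebesgue_integral_def
      by (rule integral_lborel_linear[OF L]) (intro borel_measurable_scaleR borel_measurable_indicator sb m)
    also have "\<dots> = (LINT y:shell ?q|lborel. \<phi> y * cone_density f y)"
      unfolding set_lebesgue_integral_def
    proof (rule Bochner_Integration.integral_cong[OF refl])
      fix y
      have "indicator (shell norm) (L y) = (indicator (shell ?q) y :: real)"
        by (simp add: shell_def indicator_def)
      moreover have "y \<noteq> 0" if "y \<in> shell ?q"
        using gauge.zero_notin_shell[OF q] that by blast
      ultimately show "\<bar>det (matrix L)\<bar> * (indicator (shell norm) (L y) *\<^sub>R (\<phi>' (L y) * cone_density f' (L y))) =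
          indicator (shell ?q) y *\<^sub>R (\<phi> y * cone_density f y)"
        using \<phi> dens by (cases "y \<in> shell ?q") auto
    qed
    finally show ?thesis ..
  qed
  have "average_form f u v =
      (LINT y:shell ?q|lborel. u \<bullet> (fundamental_tensor f y *v v) * cone_density f y) /
      (LINT y:shell ?q|lborel. cone_density f y)"
    unfolding f.average_form_eq_average
    by (rule f.indicatrix_average_eq[OF q f.continuous_on_fundamental_form])
      (simp add: f.fundamental_tensor_homogeneous)
  also have "\<dots> = average_form f' (L u) (L v)"
    unfolding f'.average_form_eq_norm
    using transform[OF f'.continuous_on_fundamental_form fundamental_tensor_linear(1)[OF f'.smooth_square L fL], of u v]
      transform[of "\<lambda>_. 1" "\<lambda>_. 1"] by simp
  finally show ?thesis .
qed

section \<open>The isotropic average metric on a Finsler manifold\<close>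

text \<open>Injectivity of Jacobians and of differentials of isometries comes for free from the preservation of
the Finsler function, since a Minkowski norm vanishes only at the origin.\<close>

lemma minkowski_norm_linear_inj:
  assumes f: "minkowski_norm f" and f': "minkowski_norm f'" and L: "linear L" and fL: "\<And>y. f y = f' (L y)"
  shows "inj L"
proof -
  have "y = 0" if "L y = 0" for y
    using fL[of y] minkowski_norm.zero[OF f'] minkowski_norm.eq_0_iff[OF f] that by simp
  then show ?thesis using linear_injective_0[OF L] by blast
qed

lemma frechet_derivative_slice:
  assumes "smooth_on (U \<times> V) H" "x \<in> U" "y \<in> V"
  shows "frechet_derivative (\<lambda>y. H (x, y)) (at y) v = frechet_derivative H (at (x, y)) (0, v)"
proof -
  have "((\<lambda>y. (x, y)) has_derivative (\<lambda>v. (0, v))) (at y)"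
    by (auto intro!: derivative_eq_intros)
  moreover have "(H has_derivative frechet_derivative H (at (x, y))) (at (x, y))"
    using smooth_on_has_derivative[OF assms(1)] assms(2,3) by simp
  ultimately have "((\<lambda>y. H (x, y)) has_derivative (\<lambda>v. frechet_derivative H (at (x, y)) (0, v))) (at y)"
    by (rule has_derivative_compose)
  from frechet_derivative_at[OF this] show ?thesis by metis
qed

lemma fundamental_tensor_slice:
  fixes f :: "'a::real_normed_vector \<Rightarrow> real^'n::finite \<Rightarrow> real"
  assumes f: "smooth_on (U \<times> - {0}) (\<lambda>(x, y). f x y)" and U: "open U" and x: "x \<in> U" "y \<noteq> 0"
  shows "fundamental_tensor (f x) y $ i $ j =
    (1/2) * frechet_derivative (\<lambda>z. frechet_derivative (\<lambda>(x, y). (f x y)\<^sup>2) (at z) (0, axis j 1)) (at (x, y)) (0, axis i 1)"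
proof -
  let ?H = "\<lambda>(x, y). (f x y)\<^sup>2"
  have "smooth_on (U \<times> - {0}) (\<lambda>z. (case z of (x, y) \<Rightarrow> f x y)\<^sup>2)"
    using U by (intro smooth_on_power f open_Times) (auto simp: open_Compl)
  then have H: "smooth_on (U \<times> - {0}) ?H" by (simp add: case_prod_unfold)
  let ?D = "\<lambda>z. frechet_derivative ?H (at z) (0, axis j 1)"
  have D: "smooth_on (U \<times> - {0}) ?D" by (rule smooth_on_frechet_derivative[OF H])
  have sl: "partial_deriv j (\<lambda>z. (f x z)\<^sup>2) z = ?D (x, z)" if "z \<in> - {0}" for z
    using frechet_derivative_slice[OF H x(1) that] by (simp add: partial_deriv_def)
  have "smooth_on (- {0}) (\<lambda>z. ?D ((x, 0) + (0, z)))"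
    using x(1) by (intro smooth_on_compose_affine[OF _ D]) (auto simp: open_Compl bounded_linear_Pair bounded_linear_zero bounded_linear_ident)
  then have diff: "(\<lambda>z. ?D (x, z)) differentiable at y"
    using smooth_on_has_derivative[of "- {0}" _ y] x(2) by (auto simp: differentiable_def)
  have "frechet_derivative (\<lambda>z. ?D (x, z)) (at y) = frechet_derivative (partial_deriv j (\<lambda>z. (f x z)\<^sup>2)) (at y)"
    by (rule frechet_derivative_transform_within_open[where X="- {0}"])
      (use diff sl x in \<open>auto simp: open_Compl\<close>)
  then show ?thesis
    using frechet_derivative_slice[OF D x(1), of y "axis i 1"] x(2)
    by (simp add: fundamental_tensor_def partial_deriv_def[of i])
qed

text \<open>With \<open>q = norm\<close> both integrals in the average run over a compact set that does not depend on the parameter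
and avoids the origin, where the integrands are not smooth.\<close>

lemma smooth_on_average_form:
  fixes f :: "'a::euclidean_space \<Rightarrow> real^'n::finite \<Rightarrow> real"
  assumes f: "smooth_on (U \<times> - {0}) (\<lambda>(x, y). f x y)" and U: "open U"
    and mink: "\<And>x. x \<in> U \<Longrightarrow> minkowski_norm (f x)"
  shows "smooth_on U (\<lambda>x. average_form (f x) u v)"
proof -
  let ?S = "U \<times> (- {0} :: (real^'n) set)"
  have op: "open ?S" using U by (simp add: open_Times open_Compl)
  have "smooth_on ?S (\<lambda>z. (case z of (x, y) \<Rightarrow> f x y)\<^sup>2)"
    by (intro smooth_on_power f op)
  then have "smooth_on ?S (\<lambda>(x, y). (f x y)\<^sup>2)" by (simp add: case_prod_unfold)
  then have D: "smooth_on ?S (\<lambda>z. (1/2) * frechet_derivative (\<lambda>z. frechet_derivative (\<lambda>(x, y). (f x y)\<^sup>2) (at z)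
      (0, axis j 1)) (at z) (0, axis i 1))" for i j :: 'n
    by (intro smooth_on_mult op smooth_on_const smooth_on_frechet_derivative)
  have ft: "smooth_on ?S (\<lambda>z. fundamental_tensor (f (fst z)) (snd z) $ i $ j)" for i j
  proof (rule smooth_on_cong[OF op _ D[where i=i and j=j]])
    fix z assume "z \<in> ?S"
    then obtain x y where "z = (x, y)" "x \<in> U" "y \<noteq> 0" by auto
    then show "(1/2) * frechet_derivative (\<lambda>z. frechet_derivative (\<lambda>(x, y). (f x y)\<^sup>2) (at z)
        (0, axis j 1)) (at z) (0, axis i 1) = fundamental_tensor (f (fst z)) (snd z) $ i $ j"
      using fundamental_tensor_slice[OF f U, of x y i j] by simp
  qed
  have fpos: "0 < f (fst z) (snd z)" and dpos: "0 < det (fundamental_tensor (f (fst z)) (snd z))" if "z \<in> ?S" for z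
  proof -
    have "fst z \<in> U" "snd z \<noteq> 0" using that by auto
    then show "0 < f (fst z) (snd z)" "0 < det (fundamental_tensor (f (fst z)) (snd z))"
      using minkowski_norm.pos[OF mink] minkowski_norm.det_pos[OF mink] by blast+
  qed
  have fz: "smooth_on ?S (\<lambda>z. f (fst z) (snd z))"
    using f by (simp add: case_prod_unfold)
  have dens: "smooth_on ?S (\<lambda>z. cone_density (f (fst z)) (snd z))"
    unfolding cone_density_def using fpos dpos
    by (intro smooth_on_divide smooth_on_sqrt smooth_on_det smooth_on_power op ft fz)
      (metis less_irrefl power_eq_0_iff)+
  have form: "smooth_on ?S (\<lambda>z. u \<bullet> (fundamental_tensor (f (fst z)) (snd z) *v v))"
    unfolding inner_vec_def matrix_vector_mult_def
    by (simp, intro smooth_on_sum smooth_on_mult smooth_on_const op ft)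
  have N: "smooth_on U (\<lambda>x. LINT y:shell norm|lborel. u \<bullet> (fundamental_tensor (f x) y *v v) * cone_density (f x) y)"
    using smooth_on_parametric_integral[OF U compact_shell_norm shell_norm_subset smooth_on_mult[OF op form dens]]
    by simp
  have D: "smooth_on U (\<lambda>x. LINT y:shell norm|lborel. cone_density (f x) y)"
    using smooth_on_parametric_integral[OF U compact_shell_norm shell_norm_subset dens] by simp
  have "smooth_on U (\<lambda>x. (LINT y:shell norm|lborel. u \<bullet> (fundamental_tensor (f x) y *v v) * cone_density (f x) y) /
      (LINT y:shell norm|lborel. cone_density (f x) y))"
    using minkowski_norm.integral_cone_density_pos[OF mink] by (intro smooth_on_divide U N D) (auto simp: less_le)
  then show ?thesis
    by (rule smooth_on_cong[OF U, rotated]) (simp add: minkowski_norm.average_form_eq_norm[OF mink])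
qed

locale manifold =
  fixes X :: "'a topology" and A :: "('a, 'n::finite) chart set"
  assumes manifold: "smooth_manifold X A"
begin

lemma chart_homeomorphic:
  assumes "c \<in> A"
  shows "openin X (fst c)" "open (snd c ` fst c)"
    "homeomorphic_map (subtopology X (fst c)) (top_of_set (snd c ` fst c)) (snd c)"
  using manifold assms unfolding smooth_manifold_def by blast+

lemma chart_inj: "c \<in> A \<Longrightarrow> inj_on (snd c) (fst c)"
  using homeomorphic_imp_injective_map[OF chart_homeomorphic(3)] chart_homeomorphic(1)
  by (simp add: openin_subset Int_absorb1 inf.absorb2)

lemma chart_inv_chart: "c \<in> A \<Longrightarrow> p \<in> fst c \<Longrightarrow> chart_inv c (snd c p) = p"
  by (simp add: chart_inv_def chart_inj)

lemma chart_open_image: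
  assumes "c \<in> A" "openin X V" "V \<subseteq> fst c"
  shows "open (snd c ` V)"
proof -
  have "openin (subtopology X (fst c)) V"
    using assms by (auto simp: openin_subtopology)
  then have "openin (top_of_set (snd c ` fst c)) (snd c ` V)"
    using homeomorphic_imp_open_map[OF chart_homeomorphic(3)[OF assms(1)]] by (simp add: open_map_def)
  then show ?thesis
    using openin_open_trans chart_homeomorphic(2)[OF assms(1)] by blast
qed

lemma chart_at: 
  assumes "p \<in> topspace X" shows "chart_at A p \<in> A" "p \<in> fst (chart_at A p)"
proof -
  have "\<exists>c. c \<in> A \<and> p \<in> fst c"
    using assms manifold unfolding smooth_manifold_def by blast
  then have "chart_at A p \<in> A \<and> p \<in> fst (chart_at A p)"
    unfolding chart_at_def by (rule someI_ex)
  then show "chart_at A p \<in> A" "p \<in> fst (chart_at A p)" by auto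
qed

lemma chart_subset: "c \<in> A \<Longrightarrow> fst c \<subseteq> topspace X"
  using chart_homeomorphic(1) openin_subset by blast

lemma transition_has_derivative:
  assumes "c \<in> A" "d \<in> A" "p \<in> fst c" "p \<in> fst d"
  shows "(transition c d has_derivative frechet_derivative (transition c d) (at (snd c p))) (at (snd c p))"
proof -
  have "smooth_on (snd c ` (fst c \<inter> fst d)) (transition c d)"
    using manifold assms unfolding smooth_manifold_def by blast
  then show ?thesis using assms by (intro smooth_on_has_derivative) auto
qed

lemma transition_chart: "c \<in> A \<Longrightarrow> p \<in> fst c \<Longrightarrow> transition c d (snd c p) = snd d p"
  by (simp add: transition_def chart_inv_chart)

text \<open>The chain rule for a map into the manifold under a change of the chart in the target. With the identity
for \<open>\<Phi>\<close> it is the cocycle property of the Jacobians of the transition maps.\<close>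

lemma frechet_derivative_transition_compose:
  assumes cde: "c \<in> A" "d \<in> A" "e \<in> A" and \<Phi>: "continuous_map X X \<Phi>" and p: "p \<in> fst c" "\<Phi> p \<in> fst d" "\<Phi> p \<in> fst e"
    and diff: "(snd d \<circ> \<Phi> \<circ> chart_inv c) differentiable at (snd c p)"
  shows "frechet_derivative (snd e \<circ> \<Phi> \<circ> chart_inv c) (at (snd c p)) y =
    frechet_derivative (transition d e) (at (snd d (\<Phi> p)))
      (frechet_derivative (snd d \<circ> \<Phi> \<circ> chart_inv c) (at (snd c p)) y)"
proof -
  let ?g = "snd d \<circ> \<Phi> \<circ> chart_inv c" and ?V = "fst c \<inter> {p \<in> topspace X. \<Phi> p \<in> fst d \<inter> fst e}"
  have "openin X {p \<in> topspace X. \<Phi> p \<in> fst d \<inter> fst e}"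
    using cde chart_homeomorphic(1) by (intro openin_continuous_map_preimage[OF \<Phi>] openin_Int) auto
  then have op: "open (snd c ` ?V)"
    using cde chart_homeomorphic(1) by (intro chart_open_image openin_Int) auto
  have g: "?g (snd c p) = snd d (\<Phi> p)" using cde p by (simp add: chart_inv_chart)
  have "(?g has_derivative frechet_derivative ?g (at (snd c p))) (at (snd c p))"
    using diff by (simp add: frechet_derivative_works)
  moreover have "(transition d e has_derivative frechet_derivative (transition d e) (at (snd d (\<Phi> p)))) (at (?g (snd c p)))"
    unfolding g by (rule transition_has_derivative) (use cde p in auto)
  ultimately have "((\<lambda>x. transition d e (?g x)) has_derivative
      (\<lambda>y. frechet_derivative (transition d e) (at (snd d (\<Phi> p))) (frechet_derivative ?g (at (snd c p)) y))) (at (snd c p))"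
    by (rule has_derivative_compose)
  then have "((snd e \<circ> \<Phi> \<circ> chart_inv c) has_derivative
      (\<lambda>y. frechet_derivative (transition d e) (at (snd d (\<Phi> p))) (frechet_derivative ?g (at (snd c p)) y))) (at (snd c p))"
  proof (rule has_derivative_transform_within_open[OF _ op])
    have "p \<in> ?V" using p chart_subset[OF cde(1)] by auto
    then show "snd c p \<in> snd c ` ?V" by (rule imageI)
    show "transition d e (?g x) = (snd e \<circ> \<Phi> \<circ> chart_inv c) x" if "x \<in> snd c ` ?V" for x
      using that cde by (auto simp: chart_inv_chart transition_chart)
  qed
  from frechet_derivative_at[OF this] show ?thesis by metis
qed

lemma frechet_derivative_transition_trans:
  assumes "c \<in> A" "d \<in> A" "e \<in> A" "p \<in> fst c" "p \<in> fst d" "p \<in> fst e"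
  shows "frechet_derivative (transition c e) (at (snd c p)) y =
    frechet_derivative (transition d e) (at (snd d p)) (frechet_derivative (transition c d) (at (snd c p)) y)"
  using frechet_derivative_transition_compose[of c d e id p y] transition_has_derivative[of c d p] assms
  by (auto simp: transition_def differentiable_def)

lemma frechet_derivative_transition_self:
  assumes "c \<in> A" "p \<in> fst c"
  shows "frechet_derivative (transition c c) (at (snd c p)) y = y"
proof -
  have "((\<lambda>x. x) has_derivative (\<lambda>y. y)) (at (snd c p))" by simp
  then have "(transition c c has_derivative (\<lambda>y. y)) (at (snd c p))"
    by (rule has_derivative_transform_within_open[OF _ chart_homeomorphic(2)[OF assms(1)]])
      (use assms in \<open>auto simp: transition_chart[OF assms(1)]\<close>)
  from frechet_derivative_at[OF this] show ?thesis by metis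
qed

lemma linear_transition:
  assumes "c \<in> A" "d \<in> A" "p \<in> fst c" "p \<in> fst d"
  shows "linear (frechet_derivative (transition c d) (at (snd c p)))"
  by (rule has_derivative_linear[OF transition_has_derivative[OF assms]])

lemma coord_vector_in_tangent_space:
  assumes "c \<in> A" "p \<in> fst c" shows "coord_vector A c p y \<in> tangent_space A p"
  unfolding tangent_space_def
proof (intro CollectI conjI ballI allI impI)
  fix d e assume "d \<in> A" "e \<in> A" "p \<in> fst d \<and> p \<in> fst e"
  then show "coord_vector A c p y e =
      frechet_derivative (transition d e) (at (snd d p)) (coord_vector A c p y d)"
    using frechet_derivative_transition_trans[OF assms(1), of d e p y] assms(2)
    by (simp add: coord_vector_def)
qed (auto simp: coord_vector_def)

lemma coord_vector_self: "c \<in> A \<Longrightarrow> p \<in> fst c \<Longrightarrow> coord_vector A c p y c = y"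
  by (simp add: coord_vector_def frechet_derivative_transition_self)

lemma tangent_transition:
  assumes "c \<in> A" "p \<in> fst c" "d \<in> A" "p \<in> fst d" "v \<in> tangent_space A p"
  shows "v d = frechet_derivative (transition c d) (at (snd c p)) (v c)"
  using assms unfolding tangent_space_def by blast

lemma coord_vector_tangent:
  assumes "c \<in> A" "p \<in> fst c" "v \<in> tangent_space A p" shows "coord_vector A c p (v c) = v"
proof
  fix d
  show "coord_vector A c p (v c) d = v d"
  proof (cases "d \<in> A \<and> p \<in> fst d")
    case True
    then show ?thesis using tangent_transition[OF assms(1,2) _ _ assms(3), of d] by (simp add: coord_vector_def)
  next
    case False
    then have "v d = 0" using assms(3) unfolding tangent_space_def by blast
    then show ?thesis unfolding coord_vector_def if_not_P[OF False] by simp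
  qed
qed

lemma coord_vector_scaleR:
  assumes "c \<in> A" "p \<in> fst c"
  shows "coord_vector A c p (t *\<^sub>R y) = (\<lambda>d. t *\<^sub>R coord_vector A c p y d)"
  using assms linear_cmul[OF linear_transition] by (auto simp: coord_vector_def fun_eq_iff)

lemma coord_vector_zero:
  assumes "c \<in> A" "p \<in> fst c" shows "coord_vector A c p 0 = (\<lambda>_. 0)"
  using assms linear_0[OF linear_transition] by (auto simp: coord_vector_def fun_eq_iff)

lemma differential_has_derivative:
  assumes "smooth_map X A \<Phi>" "c \<in> A" "d \<in> A" "p \<in> fst c" "\<Phi> p \<in> fst d"
  shows "((snd d \<circ> \<Phi> \<circ> chart_inv c) has_derivative
    frechet_derivative (snd d \<circ> \<Phi> \<circ> chart_inv c) (at (snd c p))) (at (snd c p))"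
proof -
  have "smooth_on (snd c ` {p \<in> fst c. \<Phi> p \<in> fst d}) (snd d \<circ> \<Phi> \<circ> chart_inv c)"
    using assms unfolding smooth_map_def by blast
  then show ?thesis using assms by (intro smooth_on_has_derivative) auto
qed

lemma differential_in_tangent_space:
  assumes \<Phi>: "smooth_map X A \<Phi>" and p: "p \<in> topspace X"
  shows "differential A \<Phi> p v \<in> tangent_space A (\<Phi> p)"
proof -
  have "continuous_map X X \<Phi>" using \<Phi> by (simp add: smooth_map_def)
  note comp = frechet_derivative_transition_compose[OF chart_at(1)[OF p] _ _ this chart_at(2)[OF p]]
  have "(snd d \<circ> \<Phi> \<circ> chart_inv (chart_at A p)) differentiable at (snd (chart_at A p) p)"
    if "d \<in> A" "\<Phi> p \<in> fst d" for d
    using differential_has_derivative[OF \<Phi> chart_at(1)[OF p] that(1) chart_at(2)[OF p] that(2)]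
    by (auto simp: differentiable_def)
  note comp = comp[OF _ _ _ _ this]
  show ?thesis
    unfolding tangent_space_def
  proof (intro CollectI conjI ballI allI impI)
    fix d e assume "d \<in> A" "e \<in> A" "\<Phi> p \<in> fst d \<and> \<Phi> p \<in> fst e"
    then show "differential A \<Phi> p v e =
        frechet_derivative (transition d e) (at (snd d (\<Phi> p))) (differential A \<Phi> p v d)"
      using comp[of d e "v (chart_at A p)"] by (simp add: differential_def Let_def)
  qed (auto simp: differential_def)
qed

end

locale finsler = 
  fixes X :: "'a topology" and A :: "('a, 'n::finite) chart set" and F :: "'a \<Rightarrow> ('a, 'n) tangent \<Rightarrow> real"
  assumes finsler: "finsler_space X A F"
begin

sublocale manifold X A
  using finsler by unfold_locales (simp add: finsler_space_def)

lemma finsler_coord_chart: "c \<in> A \<Longrightarrow> p \<in> fst c \<Longrightarrow> finsler_coord A F c (snd c p) y = F p (coord_vector A c p y)"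
  by (simp add: finsler_coord_def chart_inv_chart)

lemma finsler_coord_tangent:
  assumes "c \<in> A" "p \<in> fst c" "v \<in> tangent_space A p"
  shows "F p v = finsler_coord A F c (snd c p) (v c)"
  using assms by (simp add: finsler_coord_chart coord_vector_tangent)

lemma finsler_coord_smooth:
  "c \<in> A \<Longrightarrow> smooth_on (snd c ` fst c \<times> - {0}) (\<lambda>(x, y). finsler_coord A F c x y)"
  using finsler unfolding finsler_space_def by blast

lemma finsler_coord_minkowski:
  assumes c: "c \<in> A" and x: "x \<in> snd c ` fst c"
  shows "minkowski_norm (finsler_coord A F c x)"
proof
  obtain p where p: "p \<in> fst c" "x = snd c p" using x by blast
  have pX: "p \<in> topspace X" using chart_subset c p by blast
  note t = coord_vector_in_tangent_space[OF c p(1)]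
  have "smooth_on (- {0}) (\<lambda>y. case (x, 0) + (0, y) of (x, y) \<Rightarrow> finsler_coord A F c x y)"
    using x by (intro smooth_on_compose_affine[OF _ finsler_coord_smooth[OF c]])
      (auto simp: open_Compl bounded_linear_Pair bounded_linear_zero bounded_linear_ident)
  then show "smooth_on (- {0}) (finsler_coord A F c x)" by simp
  show "finsler_coord A F c x (s *\<^sub>R y) = s * finsler_coord A F c x y" if "0 \<le> s" for s y
  proof -
    have "F p (\<lambda>d. s *\<^sub>R coord_vector A c p y d) = s * F p (coord_vector A c p y)"
      using finsler pX t that unfolding finsler_space_def by blast
    then show ?thesis using c p by (simp add: finsler_coord_chart coord_vector_scaleR)
  qed
  show "0 \<le> finsler_coord A F c x y" for y
    using finsler pX t c p unfolding finsler_space_def by (simp add: finsler_coord_chart)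
  show "0 < w \<bullet> (fundamental_tensor (finsler_coord A F c x) y *v w)" if "y \<noteq> 0" "w \<noteq> 0" for y w
    using finsler c x that unfolding finsler_space_def by blast
qed

lemma isotropic_average_metric_eq_chart_at:
  "isotropic_average_metric A F p u v =
    average_form (finsler_coord A F (chart_at A p) (snd (chart_at A p) p)) (u (chart_at A p)) (v (chart_at A p))"
  by (simp add: isotropic_average_metric_def average_form_def Let_def)

text \<open>Chart independence: the Jacobian of a transition map is a linear map that carries the coordinate
expressions of \<open>F p\<close> in the two charts into each other.\<close>

lemma isotropic_average_metric_chart:
  assumes c: "c \<in> A" "p \<in> fst c" and uv: "u \<in> tangent_space A p" "v \<in> tangent_space A p"
  shows "isotropic_average_metric A F p u v = average_form (finsler_coord A F c (snd c p)) (u c) (v c)"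
proof -
  have "p \<in> topspace X" using chart_subset c by blast
  note d = chart_at[OF this]
  let ?d = "chart_at A p" and ?L = "frechet_derivative (transition c (chart_at A p)) (at (snd c p))"
  have f: "minkowski_norm (finsler_coord A F c (snd c p))"
    and f': "minkowski_norm (finsler_coord A F ?d (snd ?d p))"
    using finsler_coord_minkowski c d by auto
  have L: "linear ?L" by (rule linear_transition[OF c(1) d(1) c(2) d(2)])
  have fL: "finsler_coord A F c (snd c p) y = finsler_coord A F ?d (snd ?d p) (?L y)" for y
    using finsler_coord_tangent[OF d coord_vector_in_tangent_space[OF c]] c d
    by (simp add: finsler_coord_chart coord_vector_def)
  show ?thesis
    unfolding isotropic_average_metric_eq_chart_at
    using average_form_linear[OF f f' L minkowski_norm_linear_inj[OF f f' L fL] fL, of "u c" "v c"]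
      tangent_transition[OF c d] uv by simp
qed

lemma isotropic_average_metric_riemannian:
  "riemannian_metric X A (isotropic_average_metric A F)"
  unfolding riemannian_metric_def
proof (intro conjI ballI allI impI)
  fix p assume p: "p \<in> topspace X"
  let ?c = "chart_at A p"
  let ?f = "finsler_coord A F ?c (snd ?c p)"
  interpret minkowski_norm ?f
    using finsler_coord_minkowski chart_at[OF p] by simp
  show "isotropic_average_metric A F p u v = isotropic_average_metric A F p v u" for u v
    unfolding isotropic_average_metric_eq_chart_at by (rule average_form_sym)
  show "isotropic_average_metric A F p (\<lambda>c. a *\<^sub>R u c + b *\<^sub>R v c) w =
      a * isotropic_average_metric A F p u w + b * isotropic_average_metric A F p v w" for u v w a b
    unfolding isotropic_average_metric_eq_chart_at average_form_def
    by (simp add: algebra_simps sum_distrib_left sum.distrib)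
  show "0 < isotropic_average_metric A F p u u" if "u \<in> tangent_space A p" "u \<noteq> (\<lambda>_. 0)" for u
  proof -
    have "u ?c \<noteq> 0"
      using coord_vector_tangent[OF chart_at[OF p] that(1)] coord_vector_zero[OF chart_at[OF p]] that(2) by auto
    then show ?thesis unfolding isotropic_average_metric_eq_chart_at by (rule average_form_pos)
  qed
next
  fix c i j assume c: "c \<in> A"
  have "smooth_on (snd c ` fst c) (\<lambda>x. average_form (finsler_coord A F c x) (axis i 1) (axis j 1))"
    by (rule smooth_on_average_form[OF finsler_coord_smooth[OF c] chart_homeomorphic(2)[OF c] finsler_coord_minkowski[OF c]])
  then show "smooth_on (snd c ` fst c) (\<lambda>x. let p = chart_inv c x in
      isotropic_average_metric A F p (coord_vector A c p (axis i 1)) (coord_vector A c p (axis j 1)))"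
  proof (rule smooth_on_cong[OF chart_homeomorphic(2)[OF c], rotated])
    fix x assume "x \<in> snd c ` fst c"
    then obtain p where p: "p \<in> fst c" "x = snd c p" by blast
    note t = coord_vector_in_tangent_space[OF c p(1)]
    show "average_form (finsler_coord A F c x) (axis i 1) (axis j 1) = (let p = chart_inv c x in
      isotropic_average_metric A F p (coord_vector A c p (axis i 1)) (coord_vector A c p (axis j 1)))"
      using isotropic_average_metric_chart[OF c p(1) t t] c p
      by (simp add: chart_inv_chart coord_vector_self)
  qed
qed

text \<open>In coordinates the differential of \<open>\<Phi>\<close> at \<open>p\<close> is a linear map \<open>L\<close> with \<open>F p = F (\<Phi> p) \<circ> L\<close>, to which the
invariance of averages applies.\<close>

lemma finsler_isometry_imp_riemannian_isometry:
  assumes iso: "finsler_isometry X A F \<Phi>"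
  shows "riemannian_isometry X A (isotropic_average_metric A F) \<Phi>"
  unfolding riemannian_isometry_def
proof (intro conjI ballI)
  show diffeo: "diffeomorphism X A \<Phi>" using iso by (simp add: finsler_isometry_def)
  then have \<Phi>: "smooth_map X A \<Phi>" by (simp add: diffeomorphism_def)
  fix p u v assume p: "p \<in> topspace X"
  have \<Phi>p: "\<Phi> p \<in> topspace X" using diffeo p by (auto simp: diffeomorphism_def bij_betw_def)
  note c = chart_at[OF p] and d = chart_at[OF \<Phi>p]
  let ?c = "chart_at A p" and ?d = "chart_at A (\<Phi> p)"
  let ?L = "frechet_derivative (snd ?d \<circ> \<Phi> \<circ> chart_inv ?c) (at (snd ?c p))"
  have f: "minkowski_norm (finsler_coord A F ?c (snd ?c p))"
    and f': "minkowski_norm (finsler_coord A F ?d (snd ?d (\<Phi> p)))"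
    using finsler_coord_minkowski c d by auto
  have L: "linear ?L"
    by (rule has_derivative_linear[OF differential_has_derivative[OF \<Phi> c(1) d(1) c(2) d(2)]])
  have dL: "differential A \<Phi> p w ?d = ?L (w ?c)" for w
    using d by (simp add: differential_def Let_def)
  have fL: "finsler_coord A F ?c (snd ?c p) y = finsler_coord A F ?d (snd ?d (\<Phi> p)) (?L y)" for y
  proof -
    let ?y = "coord_vector A ?c p y"
    have "finsler_coord A F ?c (snd ?c p) y = F p ?y" by (rule finsler_coord_chart[OF c])
    also have "\<dots> = F (\<Phi> p) (differential A \<Phi> p ?y)"
      using iso p coord_vector_in_tangent_space[OF c] by (simp add: finsler_isometry_def)
    also have "\<dots> = finsler_coord A F ?d (snd ?d (\<Phi> p)) (?L y)"
      using finsler_coord_tangent[OF d differential_in_tangent_space[OF \<Phi> p]] dL coord_vector_self[OF c] by simp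
    finally show ?thesis .
  qed
  show "isotropic_average_metric A F (\<Phi> p) (differential A \<Phi> p u) (differential A \<Phi> p v) =
      isotropic_average_metric A F p u v"
    unfolding isotropic_average_metric_eq_chart_at dL
    by (rule average_form_linear[OF f f' L minkowski_norm_linear_inj[OF f f' L fL] fL, symmetric])
qed

end

theorem theorem6p4:
  fixes X :: "'a topology"
    and A :: "('a, 'n::finite) chart set"
    and F :: "'a \<Rightarrow> ('a, 'n) tangent \<Rightarrow> real"
  assumes "finsler_space X A F"
    and "finsler_symmetric X A F"
  shows "riemannian_symmetric_space X A (isotropic_average_metric A F)"
proof -
  interpret finsler X A F by unfold_locales (rule assms(1))
  show ?thesis
    unfolding riemannian_symmetric_space_def
    using manifold isotropic_average_metric_riemannian finsler_isometry_imp_riemannian_isometry assms(2)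
    unfolding finsler_symmetric_def by blast
qed

end
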